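(* Let $q\in(0,1)$, $\nu>-1$ and $s\in\{2,3\}$. Write $J_\nu^{(s)\prime}(w;q)$ for the derivative of $z\mapsto J_\nu^{(s)}(z;q)$ evaluated at $z=w$. The following statements hold. (a) If $\alpha\in[0,1)$ and $\nu>0$, then $r^{\ast}_{\alpha}\big(f_{\nu}^{(s)}\big)=x_{\nu,\alpha,1}$, where $x_{\nu,\alpha,1}$ is the smallest positive root (in $r$) of the equation $$r\,J_{\nu}^{(s)\prime}(r;q)-\alpha\nu\, J_{\nu}^{(s)}(r;q)=0.$$ Moreover, if $\alpha\in[0,1)$ and $\nu\in(-1,0)$, then $r^{\ast}_{\alpha}\big(f_{\nu}^{(s)}\big)=x_{\nu,\alpha}$, where $x_{\nu,\alpha}$ is the unique positive root (in $r$) of the equation $$ir\,J_{\nu}^{(s)\prime}(ir;q)-\alpha\nu\, J_{\nu}^{(s)}(ir;q)=0.$$ (b) If $\alpha\in[0,1)$, then $r^{\ast}_{\alpha}\big(g_{\nu}^{(s)}\big)=y_{\nu,\alpha,1}$, where $y_{\nu,\alpha,1}$ is the smallest positive root of the equation $$r\,J_{\nu}^{(s)\prime}(r;q)-(\alpha+\nu-1)\,J_{\nu}^{(s)}(r;q)=0.$$ (c) If $\alpha\in[0,1)$, then $r^{\ast}_{\alpha}\big(h_{\nu}^{(s)}\big)=z_{\nu,\alpha,1}$, where $z_{\nu,\alpha,1}$ is the smallest positive root of the equation $$r\,J_{\nu}^{(s)\prime}(r;q)-(2\alpha+\nu-2)\,J_{\nu}^{(s)}(r;q)=0.$$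
   Context: For $q\in(0,1)$ let $(a;q)_0=1$, $(a;q)_n=\prod_{k=1}^n(1-aq^{k-1})$, $(a;q)_\infty=\prod_{k\ge1}(1-aq^{k-1})$. For $\nu>-1$ the Jackson and Hahn-Exton $q$-Bessel functions are $$J_{\nu}^{(2)}(z;q)=\frac{(q^{\nu+1};q)_{\infty}}{(q;q)_{\infty}}\sum_{n\geq0}\frac{(-1)^n(z/2)^{2n+\nu}}{(q;q)_n(q^{\nu+1};q)_n}q^{n(n+\nu)},$$ $$J_{\nu}^{(3)}(z;q)=\frac{(q^{\nu+1};q)_{\infty}}{(q;q)_{\infty}}\sum_{n\geq0}\frac{(-1)^nz^{2n+\nu}}{(q;q)_n(q^{\nu+1};q)_n}q^{\frac12n(n+1)}.$$ Put $c_\nu(q)=(q;q)_\infty/(q^{\nu+1};q)_\infty$. The normalized functions are $$f_{\nu}^{(2)}(z;q)=\big(2^{\nu}c_{\nu}(q)J_{\nu}^{(2)}(z;q)\big)^{1/\nu}\ (\nu\ne0),\quad g_{\nu}^{(2)}(z;q)=2^{\nu}c_{\nu}(q)z^{1-\nu}J_{\nu}^{(2)}(z;q),\quad h_{\nu}^{(2)}(z;q)=2^{\nu}c_{\nu}(q)z^{1-\nu/2}J_{\nu}^{(2)}(\sqrt z;q),$$ $$f_{\nu}^{(3)}(z;q)=\big(c_{\nu}(q)J_{\nu}^{(3)}(z;q)\big)^{1/\nu}\ (\nu\ne0),\quad g_{\nu}^{(3)}(z;q)=c_{\nu}(q)z^{1-\nu}J_{\nu}^{(3)}(z;q),\quad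 h_{\nu}^{(3)}(z;q)=c_{\nu}(q)z^{1-\nu/2}J_{\nu}^{(3)}(\sqrt z;q).$$ Powers of $z$ are combined so that each of these functions is analytic near $0$ with value $0$ and derivative $1$ at $0$. Let $\mathbb{D}_r=\{z\in\mathbb{C}:|z|<r\}$. For $\alpha\in[0,1)$ the radius of starlikeness of order $\alpha$ of $f$ (with $f(0)=0$, $f'(0)=1$) is $$r^{\ast}_{\alpha}(f)=\sup\Big\{r>0:\ \operatorname{Re}\Big(\frac{zf'(z)}{f(z)}\Big)>\alpha\ \text{ for all } z\in\mathbb{D}_r\Big\}.$$
   Formalization: In (c) the printed equation is false (its smallest positive root is the square root of the radius); it is corrected by replacing r with √r: √r J'(√r;q) − (2α+ν−2) J(√r;q) = 0. *)

theory Defs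
  imports "HOL-Complex_Analysis.Complex_Analysis"
begin

section \<open>The Jackson and Hahn-Exton q-Bessel functions\<close>

definition qpoch :: "real \<Rightarrow> real \<Rightarrow> nat \<Rightarrow> real" where
  "qpoch a q n = (\<Prod>k=1..n. 1 - a * q ^ (k - 1))"

definition qpoch_inf :: "real \<Rightarrow> real \<Rightarrow> real" where
  "qpoch_inf a q = (\<Prod>k. 1 - a * q ^ k)"

text \<open>Principal powers with a real exponent. Unlike \<open>powr\<close>, where \<open>0 powr 0 = 0\<close>, the
  exponent \<open>0\<close> always gives \<open>1\<close>, so that the order-\<open>0\<close> functions have the value \<open>1\<close> at \<open>0\<close>.\<close>

definition cpow :: "complex \<Rightarrow> real \<Rightarrow> complex" where
  "cpow z a = (if a = 0 then 1 else z powr complex_of_real a)"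

definition jackson_bessel :: "real \<Rightarrow> real \<Rightarrow> complex \<Rightarrow> complex" where
  "jackson_bessel \<nu> q z =
     complex_of_real (qpoch_inf (q powr (\<nu> + 1)) q / qpoch_inf q q) *
     (\<Sum>n. (-1) ^ n * cpow (z / 2) (2 * real n + \<nu>)
            / complex_of_real (qpoch q q n * qpoch (q powr (\<nu> + 1)) q n)
            * complex_of_real (q powr (real n * (real n + \<nu>))))"

definition hahn_exton_bessel :: "real \<Rightarrow> real \<Rightarrow> complex \<Rightarrow> complex" where
  "hahn_exton_bessel \<nu> q z =
     complex_of_real (qpoch_inf (q powr (\<nu> + 1)) q / qpoch_inf q q) *
     (\<Sum>n. (-1) ^ n * cpow z (2 * real n + \<nu>)
            / complex_of_real (qpoch q q n * qpoch (q powr (\<nu> + 1)) q n)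
            * complex_of_real (q powr (real n * (real n + 1) / 2)))"

text \<open>The upper index \<open>s\<close> is \<open>2\<close> (Jackson) or \<open>3\<close> (Hahn-Exton).\<close>

definition qbessel :: "nat \<Rightarrow> real \<Rightarrow> real \<Rightarrow> complex \<Rightarrow> complex" where
  "qbessel s \<nu> q = (if s = 2 then jackson_bessel \<nu> q else hahn_exton_bessel \<nu> q)"

definition c_const :: "real \<Rightarrow> real \<Rightarrow> real" where
  "c_const \<nu> q = qpoch_inf q q / qpoch_inf (q powr (\<nu> + 1)) q"

definition norm_const :: "nat \<Rightarrow> real \<Rightarrow> real \<Rightarrow> real" where
  "norm_const s \<nu> q = (if s = 2 then 2 powr \<nu> * c_const \<nu> q else c_const \<nu> q)"


section \<open>The normalized functions\<close>

text \<open>With principal powers throughout, \<open>z powr (1 - \<nu>) * z powr \<nu> = z\<close> and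
  \<open>z powr (1 - \<nu>/2) * csqrt z powr \<nu> = z\<close> hold at every \<open>z\<close>, on the branch cut as well.
  Hence the following two formulas already are entire functions of \<open>z\<close>.\<close>

definition g_norm :: "nat \<Rightarrow> real \<Rightarrow> real \<Rightarrow> complex \<Rightarrow> complex" where
  "g_norm s \<nu> q z = complex_of_real (norm_const s \<nu> q) * cpow z (1 - \<nu>) * qbessel s \<nu> q z"

definition h_norm :: "nat \<Rightarrow> real \<Rightarrow> real \<Rightarrow> complex \<Rightarrow> complex" where
  "h_norm s \<nu> q z =
     complex_of_real (norm_const s \<nu> q) * cpow z (1 - \<nu> / 2) * qbessel s \<nu> q (csqrt z)"

text \<open>The \<open>1/\<nu>\<close>-th power cannot be the principal one: \<open>z powr \<nu>\<close> does not determine \<open>z\<close> when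
  \<open>\<nu> > 1\<close>, and even \<open>z powr (-\<nu>) * qbessel s \<nu> q z\<close> may cross the negative real axis. So the
  factor \<open>z\<close> is taken out of the power, and the remaining base, which has the value \<open>1\<close> at \<open>0\<close>,
  is raised to the power \<open>1/\<nu>\<close> along its analytic branch with value \<open>1\<close> at \<open>0\<close>, continued
  radially from \<open>0\<close>.\<close>

definition log_branch :: "(complex \<Rightarrow> complex) \<Rightarrow> complex \<Rightarrow> complex" where
  "log_branch \<phi> z = contour_integral (linepath 0 z) (\<lambda>w. deriv \<phi> w / \<phi> w)"

lemma
  assumes hol: "\<phi> holomorphic_on ball 0 R" and nz: "\<And>z. z \<in> ball 0 R \<Longrightarrow> \<phi> z \<noteq> 0"
    and one: "\<phi> 0 = 1"
  shows log_branch_holomorphic: "log_branch \<phi> holomorphic_on ball 0 R"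
    and exp_log_branch: "z \<in> ball 0 R \<Longrightarrow> exp (log_branch \<phi> z) = \<phi> z"
    and log_branch_0: "log_branch \<phi> 0 = 0"
proof -
  have "\<exists>l. l holomorphic_on ball 0 R \<and> (\<forall>z\<in>ball 0 R. exp (l z) = \<phi> z)"
    using contractible_imp_holomorphic_log[OF hol _ nz]
    by (metis convex_ball convex_imp_contractible)
  then obtain l where l: "l holomorphic_on ball 0 R" "\<And>z. z \<in> ball 0 R \<Longrightarrow> exp (l z) = \<phi> z"
    by blast
  have dl: "(l has_field_derivative deriv \<phi> z / \<phi> z) (at z)" if z: "z \<in> ball 0 R" for z
  proof -
    have d: "(l has_field_derivative deriv l z) (at z)"
      using l(1) z holomorphic_derivI by blast
    have "((\<lambda>z. exp (l z)) has_field_derivative exp (l z) * deriv l z) (at z)"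
      by (rule DERIV_chain2[OF DERIV_exp d])
    then have "(\<phi> has_field_derivative exp (l z) * deriv l z) (at z)"
      by (rule has_field_derivative_transform_within_open[of _ _ _ "ball 0 R"]) (use z l(2) in auto)
    then have "deriv \<phi> z = \<phi> z * deriv l z" using l(2)[OF z] by (simp add: DERIV_imp_deriv)
    then show ?thesis using d nz[OF z] by simp
  qed
  have eq: "log_branch \<phi> z = l z - l 0" if z: "z \<in> ball 0 R" for z
  proof -
    have "0 \<in> ball (0::complex) R" using z by (auto intro: le_less_trans[OF norm_ge_zero])
    then have sub: "path_image (linepath 0 z) \<subseteq> ball 0 R"
      using z by (simp add: closed_segment_subset)
    have "((\<lambda>w. deriv \<phi> w / \<phi> w) has_contour_integral l z - l 0) (linepath 0 z)"
      using contour_integral_primitive[of "ball 0 R" l "\<lambda>w. deriv \<phi> w / \<phi> w" "linepath 0 z"]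
        dl sub by (auto intro: has_field_derivative_at_within)
    then show ?thesis unfolding log_branch_def by (rule contour_integral_unique)
  qed
  show "log_branch \<phi> holomorphic_on ball 0 R"
    by (rule holomorphic_transform[of "\<lambda>z. l z - l 0"])
      (use eq l(1) in \<open>auto intro!: holomorphic_intros\<close>)
  show "log_branch \<phi> 0 = 0" by (simp add: log_branch_def)
  show "exp (log_branch \<phi> z) = \<phi> z" if z: "z \<in> ball 0 R"
  proof -
    have "0 \<in> ball (0::complex) R" using z by (auto intro: le_less_trans[OF norm_ge_zero])
    then show ?thesis using eq[OF z] l(2) z one by (simp add: exp_diff)
  qed
qed

definition f_base :: "nat \<Rightarrow> real \<Rightarrow> real \<Rightarrow> complex \<Rightarrow> complex" where
  "f_base s \<nu> q z =
     (if z = 0 then 1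
      else complex_of_real (norm_const s \<nu> q) * cpow z (-\<nu>) * qbessel s \<nu> q z)"

definition f_norm :: "nat \<Rightarrow> real \<Rightarrow> real \<Rightarrow> complex \<Rightarrow> complex" where
  "f_norm s \<nu> q z = z * exp (log_branch (f_base s \<nu> q) z / complex_of_real \<nu>)"


section \<open>The radius of starlikeness of a given order\<close>

text \<open>At \<open>0\<close> the quotient \<open>z f'(z) / f(z)\<close> is read as its limit \<open>1 > \<alpha>\<close>, so this point imposes
  no condition (in HOL \<open>0 / 0 = 0\<close>, which would violate it). A zero of \<open>f\<close> in the punctured disc
  does violate the condition, since \<open>x / 0 = 0 \<le> \<alpha>\<close>. Holomorphy makes sure that \<open>deriv f\<close> is
  the derivative. The supremum is an extended real, so that it is meaningful for every \<open>f\<close>.\<close>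

definition starlike_radius :: "real \<Rightarrow> (complex \<Rightarrow> complex) \<Rightarrow> ereal" where
  "starlike_radius \<alpha> f =
     Sup (ereal ` {r. r > 0 \<and> f holomorphic_on ball 0 r \<and>
                      (\<forall>z \<in> ball 0 r - {0}. Re (z * deriv f z / f z) > \<alpha>)})"

definition smallest_positive_root :: "(real \<Rightarrow> complex) \<Rightarrow> real \<Rightarrow> bool" where
  "smallest_positive_root F x \<longleftrightarrow> x > 0 \<and> F x = 0 \<and> (\<forall>y. 0 < y \<and> y < x \<longrightarrow> F y \<noteq> 0)"

definition unique_positive_root :: "(real \<Rightarrow> complex) \<Rightarrow> real \<Rightarrow> bool" where
  "unique_positive_root F x \<longleftrightarrow> x > 0 \<and> F x = 0 \<and> (\<forall>y. y > 0 \<and> F y = 0 \<longrightarrow> y = x)"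

end

theory Submission
  imports Defs "HOL-Computational_Algebra.Fundamental_Theorem_Algebra"
begin

text \<open>
  Up to a constant, \<open>J(z) = z\<^sup>\<nu> P(z\<^sup>2)\<close> with an entire \<open>P\<close>, \<open>P(0) = 1\<close>. The idea is to avoid a Hadamard
  factorization of \<open>P\<close>: it is the locally uniform limit of polynomials \<open>\<Prod>i. 1 - a\<^sub>i z\<close> with all \<open>a\<^sub>i > 0\<close>,
  namely rescaled q-Laguerre polynomials (Jackson) and Wall, i.e. little q-Laguerre, polynomials
  (Hahn-Exton). These have only real zeros because of their three-term recurrence, and the alternating
  signs of the coefficients make the zeros positive. The logarithmic derivatives of the polynomials
  are \<open>- \<Sum>i. a\<^sub>i / (1 - a\<^sub>i z)\<close>, and all estimates on them that are uniform in the degree pass to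
  \<open>LP = - P' / P\<close> on the disc up to the first positive zero \<open>w1\<close> of \<open>P\<close>:
  \<open>- |z| LP(-|z|) \<le> Re (z LP(z)) \<le> |z| LP(|z|)\<close>. Since \<open>z f'(z) / f(z)\<close> equals \<open>1 - c w LP(w)\<close> with \<open>w = z\<^sup>2\<close>
  or \<open>w = z\<close>, the condition of starlikeness fails first on the real axis for \<open>c > 0\<close>, and on
  the imaginary axis for \<open>c < 0\<close>.
\<close>

text \<open>Limits of such polynomials also include exponentials such as \<open>exp (- z)\<close>,
  which have no zero; the locale assumption \<open>second\<close> excludes them through two Taylor
  coefficients. Passing to the limit weakens strict inequalities, so each strict statement needs a
  margin independent of the degree. The decisive margin comes from a polynomial zero near
  \<open>w1\<close>, whose term forces \<open>LP t \<ge> 1 / (w1 - t)\<close> for real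
  \<open>t < w1\<close>. For c > 0 this blow-up places the critical radius before the zero. For c <
  0, i.e. c = 2 / \<nu>, the same bound at \<open>t = - w1\<close> reads
  \<open>w1 * LP (- w1) \<ge> 1 / 2\<close>, so the critical point lies inside the disc as soon as -
  c / 2 > 1 - \<alpha>; since - c / 2 = - 1 / \<nu>, this is supplied by \<nu> > -1. Location inside
  the disc matters because z f'(z) / f(z) is controlled only there. Uniqueness of the imaginary
  root, in contrast, concerns all r > 0: it rests on strict monotonicity of
  \<open>t * LP (- t)\<close> and on \<open>P\<close> having no zero on the negative axis.\<close>

section \<open>Polynomials with positive zeros\<close>

text \<open>The sign of \<open>Im (p (n + 1) * cnj (p n))\<close> is that of \<open>- Im z\<close> for all \<open>n\<close>: this is the
  Christoffel-Darboux argument without an orthogonality measure.\<close>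

lemma three_term_nonreal_nonzero:
  fixes p :: "nat \<Rightarrow> complex" and A B C D :: "nat \<Rightarrow> real" and z :: complex
  assumes rec0: "A 0 * p 1 = (B 0 - D 0 * z) * p 0"
    and rec: "\<And>n. A (Suc n) * p (Suc (Suc n)) = (B (Suc n) - D (Suc n) * z) * p (Suc n) - C (Suc n) * p n"
    and A: "\<And>n. A n > 0" and C: "\<And>n. C (Suc n) \<ge> 0" and D: "\<And>n. D n > 0"
    and p0: "p 0 \<noteq> 0" and z: "Im z \<noteq> 0"
  shows "p n \<noteq> 0"
proof -
  have Im_r: "Im (of_real a * w) = a * Im w" for a w by simp
  have Im_BD: "Im ((of_real x - of_real y * z) * of_real r) = - (y * Im z * r)" for x y r by simp
  have W: "Im z * Im (p (Suc n) * cnj (p n)) < 0" for n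
  proof (induction n)
    case 0
    have "of_real (A 0) * (p 1 * cnj (p 0)) = (of_real (B 0) - of_real (D 0) * z) * of_real ((cmod (p 0))\<^sup>2)"
      using rec0 by (metis complex_norm_square mult.assoc)
    then have "Im (of_real (A 0) * (p 1 * cnj (p 0))) = Im ((of_real (B 0) - of_real (D 0) * z) * of_real ((cmod (p 0))\<^sup>2))"
      by (rule arg_cong)
    then have "A 0 * Im (p 1 * cnj (p 0)) = - (D 0 * Im z * (cmod (p 0))\<^sup>2)" by (simp only: Im_r Im_BD minus_complex.sel)
    then have "Im z * (A 0 * Im (p 1 * cnj (p 0))) = Im z * - (D 0 * Im z * (cmod (p 0))\<^sup>2)"
      by (rule arg_cong)
    then have "A 0 * (Im z * Im (p 1 * cnj (p 0))) = - (D 0 * (Im z)\<^sup>2 * (cmod (p 0))\<^sup>2)"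
      by (simp only: power2_eq_square mult_ac mult_minus_right)
    also have "\<dots> < 0" using D[of 0] p0 z by simp
    finally show ?case using A[of 0] by (simp only: One_nat_def mult_less_0_iff) linarith
  next
    case (Suc n)
    define m where "m = Suc n"
    have pm: "p m \<noteq> 0" using Suc by (auto simp: m_def)
    have "of_real (A m) * (p (Suc m) * cnj (p m)) = (of_real (A m) * p (Suc m)) * cnj (p m)" by simp
    also have "\<dots> = (of_real (B m) - of_real (D m) * z) * of_real ((cmod (p m))\<^sup>2) - of_real (C m) * (p n * cnj (p m))"
      unfolding m_def using rec[of n] by (simp only: complex_norm_square) (simp add: algebra_simps)
    finally have "Im (of_real (A m) * (p (Suc m) * cnj (p m))) = Im ((of_real (B m) - of_real (D m) * z) * of_real ((cmod (p m))\<^sup>2) - of_real (C m) * (p n * cnj (p m)))"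
      by (rule arg_cong)
    moreover have "Im (p n * cnj (p m)) = - Im (p m * cnj (p n))" by simp
    ultimately have "A m * Im (p (Suc m) * cnj (p m)) = - (D m * Im z * (cmod (p m))\<^sup>2) + C m * Im (p m * cnj (p n))"
      by (simp only: Im_r Im_BD minus_complex.sel)
    then have "A m * (Im z * Im (p (Suc m) * cnj (p m))) = - (D m * (Im z)\<^sup>2 * (cmod (p m))\<^sup>2) + C m * (Im z * Im (p m * cnj (p n)))"
      by (simp only: mult.left_commute[of "A m"]) (simp only: ring_distribs mult_ac mult_minus_right power2_eq_square)
    also have "\<dots> < 0"
    proof -
      have "D m * (Im z)\<^sup>2 * (cmod (p m))\<^sup>2 > 0" using D[of m] pm z by simp
      moreover have "C m * (Im z * Im (p m * cnj (p n))) \<le> 0"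
        using Suc C[of n] unfolding m_def by (simp only: mult_nonneg_nonpos less_imp_le)
      ultimately show ?thesis by linarith
    qed
    finally show ?case using A[of m] unfolding m_def by (simp only: mult_less_0_iff) linarith
  qed
  show ?thesis
  proof (cases n)
    case (Suc k) then show ?thesis using W[of k] by auto
  qed (use p0 in simp)
qed

text \<open>Induction on the degree: a root r is split off as the factor 1 - z / r, and the cofactor
  is rescaled by - r so that its value at 0 stays 1. The numbers \<open>a i\<close> with
  \<open>i \<ge> m\<close> are mere padding, kept positive so that positivity needs no index
  bound.\<close>

lemma poly_real_roots_prod:
  fixes p :: "complex poly"
  assumes "poly p 0 = 1" and "\<And>z. poly p z = 0 \<Longrightarrow> Im z = 0 \<and> Re z > 0"
  shows "\<exists>(m::nat) a. (\<forall>i. (0::real) < a i) \<and> (\<forall>z. poly p z = (\<Prod>i<m. 1 - a i * z))"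
  using assms
proof (induction "degree p" arbitrary: p rule: less_induct)
  case less
  show ?case
  proof (cases "degree p = 0")
    case True
    then obtain c where "p = [:c:]" by (metis degree_eq_zeroE)
    then have "poly p z = (\<Prod>i<(0::nat). 1 - complex_of_real 1 * z)" for z using less.prems by simp
    then have "(\<forall>i::nat. (1::real) > 0) \<and> (\<forall>z. poly p z = (\<Prod>i<(0::nat). 1 - complex_of_real 1 * z))" by simp
    then show ?thesis by (rule exI[of _ "\<lambda>_. 1::real", THEN exI[of _ "0::nat"]])
  next
    case False
    then have "\<not> constant (poly p)" by (simp add: constant_degree)
    then obtain r where r: "poly p r = 0" using fundamental_theorem_of_algebra by blast
    then obtain k where k: "p = [:- r, 1:] * k" by (metis poly_eq_0_iff_dvd dvdE)
    have r': "r = of_real (Re r)" "Re r > 0" using less.prems(2)[OF r] by (auto simp: complex_eq_iff)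
    then have r0: "r \<noteq> 0" by auto
    define p' where "p' = smult (- r) k"
    have "k \<noteq> 0" using k False by auto
    then have "degree p = Suc (degree k)" using k degree_mult_eq[of "[:- r, 1:]" k] by simp
    then have deg: "degree p' < degree p" using r0 by (simp add: p'_def)
    have ev: "poly p z = (1 - of_real (1 / Re r) * z) * poly p' z" for z
    proof -
      have inv: "complex_of_real (1 / Re r) = 1 / r" using r'(1) by (metis of_real_1 of_real_divide)
      have "poly p z = (z - r) * poly k z" by (simp add: k algebra_simps)
      also have "\<dots> = (1 - of_real (1 / Re r) * z) * poly p' z" unfolding inv p'_def using r0 by (simp add: field_simps)
      finally show ?thesis .
    qed
    have "poly p' 0 = 1" using ev[of 0] less.prems(1) by simp
    moreover have "Im z = 0 \<and> Re z > 0" if "poly p' z = 0" for z using less.prems(2) ev that by simp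
    ultimately obtain m :: nat and a where a: "\<forall>i. a i > (0::real)" "\<forall>z. poly p' z = (\<Prod>i<m. 1 - a i * z)"
      using less.hyps[OF deg] by blast
    show ?thesis
    proof (intro exI[of _ "Suc m"] exI[of _ "case_nat (1 / Re r) a"] conjI allI)
      show "case_nat (1 / Re r) a i > 0" for i using a(1) r'(2) by (simp split: nat.split)
      show "poly p z = (\<Prod>i<Suc m. 1 - complex_of_real (case_nat (1 / Re r) a i) * z)" for z
        unfolding prod.lessThan_Suc_shift using ev a(2) by simp
    qed
  qed
qed

text \<open>The limit function has the coefficients \<open>qcoef \<kappa> \<theta> q b\<close>, with \<open>b = q powr (\<nu> + 1)\<close>, and
  \<open>\<kappa> = b / 4\<close>, \<open>\<theta> = q\<^sup>2\<close> for the Jackson or \<open>\<kappa> = \<theta> = q\<close> for the Hahn-Exton function. Multiplied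
  by \<open>qfall q n k\<close> they are the coefficients of rescaled orthogonal polynomials: q-Laguerre for
  \<open>\<theta> = q\<^sup>2\<close>, Wall for \<open>\<theta> = q\<close>. The recurrence of the latter has constant coefficients of \<open>z\<close>
  only in the variable before rescaling, which is why \<open>qpol\<close> has a scaling factor \<open>\<rho>\<close>.\<close>

definition qcoef :: "real \<Rightarrow> real \<Rightarrow> real \<Rightarrow> real \<Rightarrow> nat \<Rightarrow> real" where
  "qcoef \<kappa> \<theta> q b k = (\<Prod>j<k. - \<kappa> * \<theta> ^ j / ((1 - q ^ Suc j) * (1 - b * q ^ j)))"

text \<open>Up to sign and a power of q this is the q-shifted factorial of q^(-n) with k factors.
  The normalization makes it tend to 1 as n grows, and it vanishes for k > n.\<close>

definition qfall :: "real \<Rightarrow> nat \<Rightarrow> nat \<Rightarrow> real" where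
  "qfall q n k = (\<Prod>j<k. 1 - q ^ n / q ^ j)"

definition qpol :: "real \<Rightarrow> real \<Rightarrow> real \<Rightarrow> real \<Rightarrow> real \<Rightarrow> nat \<Rightarrow> complex poly" where
  "qpol \<kappa> \<theta> q b \<rho> n = (\<Sum>k\<le>n. monom (of_real (qcoef \<kappa> \<theta> q b k * qfall q n k * \<rho> ^ k)) k)"

lemma qfall_eq_0: "q > 0 \<Longrightarrow> n < k \<Longrightarrow> qfall q n k = 0"
  unfolding qfall_def by (rule prod_zero) (auto intro!: bexI[of _ n])

lemma qfall_0 [simp]: "qfall q n 0 = 1" by (simp add: qfall_def)

lemma qfall_Suc: "qfall q n (Suc k) = qfall q n k * (1 - q ^ n / q ^ k)" by (simp add: qfall_def)

lemma qfall_Suc_Suc: "q > 0 \<Longrightarrow> qfall q (Suc n) (Suc k) = (1 - q ^ Suc n) * qfall q n k"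
  unfolding qfall_def prod.lessThan_Suc_shift by simp

text \<open>Rewrites the contribution of the polynomial of degree n in a three-term recurrence in
  terms of \<open>qfall q (Suc n)\<close>, so that all terms share a factor.\<close>

lemma qfall_pred: "q > 0 \<Longrightarrow> (1 - q ^ Suc n) * qfall q n k = qfall q (Suc n) k * (1 - q ^ Suc n / q ^ k)"
  using qfall_Suc_Suc[of q n k] qfall_Suc[of q "Suc n" k] by simp

lemma qfall_bounds:
  assumes "0 < q" "q < 1" shows "0 \<le> qfall q n k \<and> qfall q n k \<le> 1"
proof (cases "n < k")
  case False
  have "0 \<le> 1 - q ^ n / q ^ j \<and> 1 - q ^ n / q ^ j \<le> 1" if "j < k" for j
    using assms that False by (auto simp: divide_simps power_decreasing)
  then show ?thesis unfolding qfall_def by (auto intro!: prod_nonneg prod_le_1)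
qed (use qfall_eq_0 assms in simp)

lemma qfall_tendsto:
  assumes "0 < q" "q < 1" shows "(\<lambda>n. qfall q n k) \<longlonglongrightarrow> 1"
proof -
  have "(\<lambda>n. \<Prod>j<k. 1 - q ^ n / q ^ j) \<longlonglongrightarrow> (\<Prod>j<k. 1 - 0 / q ^ j)"
    by (intro tendsto_prod tendsto_diff tendsto_const tendsto_divide LIMSEQ_power_zero) (use assms in auto)
  then show ?thesis by (simp add: qfall_def)
qed

lemma qcoef_0 [simp]: "qcoef \<kappa> \<theta> q b 0 = 1" by (simp add: qcoef_def)

lemma qcoef_Suc: "qcoef \<kappa> \<theta> q b (Suc k) = qcoef \<kappa> \<theta> q b k * (- \<kappa> * \<theta> ^ k / ((1 - q ^ Suc k) * (1 - b * q ^ k)))"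
  by (simp add: qcoef_def)

lemma coeff_qpol: "q > 0 \<Longrightarrow> coeff (qpol \<kappa> \<theta> q b \<rho> n) k = of_real (qcoef \<kappa> \<theta> q b k * qfall q n k * \<rho> ^ k)"
  by (auto simp: qpol_def coeff_sum qfall_eq_0 not_le)

lemma poly_qpol: "poly (qpol \<kappa> \<theta> q b \<rho> n) z = (\<Sum>k\<le>n. of_real (qcoef \<kappa> \<theta> q b k * qfall q n k) * (of_real \<rho> * z) ^ k)"
  by (simp add: qpol_def poly_sum poly_monom power_mult_distrib mult_ac)

section \<open>Three-term recurrences of the q-Laguerre and Wall polynomials\<close>

lemma q_factors_pos:
  fixes q b :: real
  assumes "0 < q" "q < 1" "0 < b" "b < 1"
  shows "1 - q ^ Suc k > 0" "1 - b * q ^ k > 0"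
proof -
  show "1 - q ^ Suc k > 0" using assms power_Suc_less_one[of q k] by simp
  have "b * q ^ k \<le> b * 1" using assms by (intro mult_left_mono power_le_one) auto
  also have "\<dots> < 1" using assms by simp
  finally show "1 - b * q ^ k > 0" by simp
qed

text \<open>The recurrence read off at degree \<open>Suc k\<close>, where \<open>n\<close> is the
  index of the middle polynomial and the last term is the preceding one after
  \<open>qfall_pred\<close>. All terms contain \<open>c k * qfall q n k\<close>; what remains is a
  rational identity in \<open>Q = q ^ n\<close> and \<open>K = q ^ k\<close>.\<close>

lemma qlaguerre_coeff_rec:
  fixes q b \<kappa> :: real and n k :: nat
  assumes q: "0 < q" "q < 1" and b: "0 < b" "b < 1"
  defines "c \<equiv> qcoef \<kappa> (q\<^sup>2) q b"
  shows "(1 - b * q ^ n) * (c (Suc k) * qfall q (Suc n) (Suc k)) =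
    (1 - q ^ Suc n + q - b * q ^ n) * (c (Suc k) * qfall q n (Suc k)) - \<kappa> * q ^ (2 * n) * (c k * qfall q n k)
    - q * (c (Suc k) * (qfall q n (Suc k) * (1 - q ^ n / q ^ Suc k)))"
proof -
  define Q K where "Q = q ^ n" and "K = q ^ k"
  have K: "K > 0" "1 - b * K \<noteq> 0" "1 - q * K \<noteq> 0" "q > 0"
    using q_factors_pos[OF assms(1-4), of k] q by (auto simp: K_def)
  have e: "(q\<^sup>2) ^ k = K\<^sup>2" "q ^ (2 * n) = Q\<^sup>2" by (auto simp: K_def Q_def power_mult[symmetric] mult.commute)
  define X Y Z where "X = - \<kappa> * K\<^sup>2 / ((1 - q * K) * (1 - b * K))" and "Y = 1 - Q / K" and "Z = 1 - Q / (q * K)"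
  have "(1 - b * Q) * (X * (1 - q * Q)) =
    (1 - q * Q + q - b * Q) * (X * Y) - \<kappa> * Q\<^sup>2 - q * (X * (Y * Z))"
    using K unfolding X_def Y_def Z_def by (simp add: divide_simps power2_eq_square) (simp add: algebra_simps)
  from arg_cong[OF this, of "\<lambda>x. c k * qfall q n k * x"] show ?thesis
    unfolding c_def qcoef_Suc qfall_Suc_Suc[OF q(1)] qfall_Suc[of q n] power_Suc e Q_def[symmetric] K_def[symmetric]
      X_def[symmetric] Y_def[symmetric] Z_def[symmetric]
    by (simp add: algebra_simps)
qed

text \<open>As for the q-Laguerre case, with the scalings \<open>\<rho> = 1 / q ^ n\<close> carried
  along. The scaling of the preceding polynomial appears as \<open>q / q ^ n\<close>, which avoids
  an index \<open>n - 1\<close>. The factors \<open>W\<close>, \<open>V\<close>, \<open>T\<close>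
  are what the three scalings contribute relative to \<open>(1 / q ^ n) ^ k\<close>.\<close>

lemma wall_coeff_rec:
  fixes q b \<kappa> :: real and n k :: nat
  assumes q: "0 < q" "q < 1" and b: "0 < b" "b < 1"
  defines "c \<equiv> qcoef \<kappa> q q b"
  shows "q ^ n * (1 - b * q ^ n) * (c (Suc k) * qfall q (Suc n) (Suc k) * (1 / q ^ Suc n) ^ Suc k) =
    (q ^ n * (1 - b * q ^ n) + b * q ^ n * (1 - q ^ n) / q) * (c (Suc k) * qfall q n (Suc k) * (1 / q ^ n) ^ Suc k)
    - \<kappa> / q * (c k * qfall q n k * (1 / q ^ n) ^ k)
    - b * q ^ n / q * (c (Suc k) * (qfall q n (Suc k) * (1 - q ^ n / q ^ Suc k)) * (q / q ^ n) ^ Suc k)"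
proof -
  define Q K where "Q = q ^ n" and "K = q ^ k"
  have K: "K > 0" "1 - b * K \<noteq> 0" "1 - q * K \<noteq> 0" "q > 0" "Q > 0"
    using q_factors_pos[OF assms(1-4), of k] q by (auto simp: K_def Q_def)
  define X Y Z U V W T N A M k' R where "X = - \<kappa> * K / ((1 - q * K) * (1 - b * K))" and "Y = 1 - Q / K" and "Z = 1 - Q / (q * K)"
    and "U = b * Q / q" and "V = 1 / Q" and "W = 1 / (q * K * Q)" and "T = q * K / Q" and "N = 1 - q * Q"
    and "A = Q * (1 - b * Q)" and "M = A + b * Q * (1 - Q) / q" and "k' = \<kappa> / q" and "R = V ^ k"
  note defs = X_def Y_def Z_def U_def V_def W_def T_def N_def M_def k'_def
  have e: "(1 / (q * Q)) ^ Suc k = R * W" "(1 / Q) ^ Suc k = R * V" "(q / Q) ^ Suc k = R * T"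
    by (auto simp: R_def V_def K_def W_def T_def power_divide power_mult_distrib)
  have "A * (X * N * W) = M * (X * Y * V) - k' - U * (X * (Y * Z) * T)"
    using K unfolding defs A_def by (simp add: divide_simps power2_eq_square) (simp add: algebra_simps)
  from arg_cong[OF this, of "\<lambda>x. c k * qfall q n k * R * x"] show ?thesis
    unfolding c_def qcoef_Suc qfall_Suc_Suc[OF q(1)] qfall_Suc[of q n] power_Suc[of q] Q_def[symmetric] K_def[symmetric] e
      R_def[symmetric] A_def[symmetric] defs[symmetric]
    by (simp add: algebra_simps R_def)
qed


lemma qcoef_qfall_1:
  fixes q b \<kappa> \<theta> :: real
  assumes "0 < q" "q < 1" "b < 1"
  shows "qcoef \<kappa> \<theta> q b 1 * qfall q 1 1 = - \<kappa> / (1 - b)"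
  using assms by (simp add: qcoef_def qfall_def)

text \<open>Comparison of coefficients. In degree 0, where all polynomials have coefficient 1, the
  identity is just A = B - C in the notation of \<open>three_term_nonreal_nonzero\<close>.\<close>

lemma qlaguerre_rec:
  fixes q b \<kappa> :: real and z :: complex
  assumes q: "0 < q" "q < 1" and b: "0 < b" "b < 1"
  defines "p \<equiv> \<lambda>n. poly (qpol \<kappa> (q\<^sup>2) q b 1 n) z"
  shows "of_real (1 - b) * p 1 = (of_real (1 - b) - of_real \<kappa> * z) * p 0"
    and "of_real (1 - b * q ^ Suc n) * p (Suc (Suc n)) =
      (of_real (1 - q ^ Suc (Suc n) + q - b * q ^ Suc n) - of_real (\<kappa> * q ^ (2 * Suc n)) * z) * p (Suc n)
      - of_real (q * (1 - q ^ Suc n)) * p n"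
proof -
  have "p 1 = 1 + of_real (qcoef \<kappa> (q\<^sup>2) q b 1 * qfall q 1 1) * (of_real (1) * z)" by (simp add: p_def poly_qpol)
  moreover have "p 0 = 1" by (simp add: p_def poly_qpol)
  ultimately show "of_real (1 - b) * p 1 = (of_real (1 - b) - of_real \<kappa> * z) * p 0"
    unfolding qcoef_qfall_1[OF q b(2)] using b q by (simp add: field_simps)
next
  let ?P = "qpol \<kappa> (q\<^sup>2) q b 1"
  define m where "m = Suc n"
  have "smult (of_real (1 - b * q ^ m)) (?P (Suc m)) =
      smult (of_real (1 - q ^ Suc m + q - b * q ^ m)) (?P m) - smult (of_real (\<kappa> * q ^ (2 * m))) (pCons 0 (?P m))
      - smult (of_real (q * (1 - q ^ m))) (?P n)"
  proof (rule poly_eqI)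
    fix k
    show "coeff (smult (of_real (1 - b * q ^ m)) (?P (Suc m))) k =
      coeff (smult (of_real (1 - q ^ Suc m + q - b * q ^ m)) (?P m) - smult (of_real (\<kappa> * q ^ (2 * m))) (pCons 0 (?P m))
      - smult (of_real (q * (1 - q ^ m))) (?P n)) k"
    proof (cases k)
      case 0
      then show ?thesis using q by (simp add: coeff_qpol algebra_simps m_def)
    next
      case (Suc l)
      have *: "q * (1 - q ^ m) * (qcoef \<kappa> (q\<^sup>2) q b k * qfall q n k) = q * (qcoef \<kappa> (q\<^sup>2) q b k * (qfall q m k * (1 - q ^ m / q ^ k)))"
        using qfall_pred[OF q(1), of n k] by (simp add: m_def mult_ac)
      have "(1 - b * q ^ m) * (qcoef \<kappa> (q\<^sup>2) q b k * qfall q (Suc m) k) =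
        (1 - q ^ Suc m + q - b * q ^ m) * (qcoef \<kappa> (q\<^sup>2) q b k * qfall q m k) - \<kappa> * q ^ (2 * m) * (qcoef \<kappa> (q\<^sup>2) q b l * qfall q m l)
        - q * (1 - q ^ m) * (qcoef \<kappa> (q\<^sup>2) q b k * qfall q n k)"
        unfolding * using qlaguerre_coeff_rec[OF assms(1-4), of m \<kappa> l] Suc by simp
      from arg_cong[OF this, of complex_of_real] show ?thesis
        using q(1) Suc by (simp add: coeff_qpol)
    qed
  qed
  from arg_cong[OF this, of "\<lambda>p. poly p z"]
  show "of_real (1 - b * q ^ Suc n) * p (Suc (Suc n)) =
      (of_real (1 - q ^ Suc (Suc n) + q - b * q ^ Suc n) - of_real (\<kappa> * q ^ (2 * Suc n)) * z) * p (Suc n)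
      - of_real (q * (1 - q ^ Suc n)) * p n"
    unfolding p_def m_def by (simp only: poly_smult poly_diff poly_pCons) (simp add: algebra_simps)
qed

lemma wall_rec:
  fixes q b \<kappa> :: real and z :: complex
  assumes q: "0 < q" "q < 1" and b: "0 < b" "b < 1"
  defines "p \<equiv> \<lambda>n. poly (qpol \<kappa> q q b (1 / q ^ n) n) z"
  shows "of_real (1 - b) * p 1 = (of_real (1 - b) - of_real (\<kappa> / q) * z) * p 0"
    and "of_real (q ^ Suc n * (1 - b * q ^ Suc n)) * p (Suc (Suc n)) =
      (of_real (q ^ Suc n * (1 - b * q ^ Suc n) + b * q ^ Suc n * (1 - q ^ Suc n) / q) - of_real (\<kappa> / q) * z) * p (Suc n)
      - of_real (b * q ^ Suc n / q * (1 - q ^ Suc n)) * p n"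
proof -
  have "p 1 = 1 + of_real (qcoef \<kappa> (q) q b 1 * qfall q 1 1) * (of_real (1 / q) * z)" by (simp add: p_def poly_qpol)
  moreover have "p 0 = 1" by (simp add: p_def poly_qpol)
  ultimately show "of_real (1 - b) * p 1 = (of_real (1 - b) - of_real (\<kappa> / q) * z) * p 0"
    unfolding qcoef_qfall_1[OF q b(2)] using b q by (simp add: field_simps)
next
  let ?P = "\<lambda>n. qpol \<kappa> q q b (1 / q ^ n) n"
  define m where "m = Suc n"
  define A B U where "A = q ^ m * (1 - b * q ^ m)" and "B = q ^ m * (1 - b * q ^ m) + b * q ^ m * (1 - q ^ m) / q"
    and "U = b * q ^ m / q"
  have AB: "A = B - U * (1 - q ^ m)" by (simp add: A_def B_def U_def)
  have "smult (of_real A) (?P (Suc m)) =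
      smult (of_real B) (?P m) - smult (of_real (\<kappa> / q)) (pCons 0 (?P m))
      - smult (of_real (U * (1 - q ^ m))) (?P n)"
  proof (rule poly_eqI)
    fix k
    show "coeff (smult (of_real A) (?P (Suc m))) k =
      coeff (smult (of_real B) (?P m) - smult (of_real (\<kappa> / q)) (pCons 0 (?P m))
      - smult (of_real (U * (1 - q ^ m))) (?P n)) k"
    proof (cases k)
      case 0
      then show ?thesis using q AB by (simp add: coeff_qpol)
    next
      case (Suc l)
      have "(q / q ^ m) = 1 / q ^ n" using q by (simp add: m_def)
      then have *: "U * (1 - q ^ m) * (qcoef \<kappa> q q b k * qfall q n k * (1 / q ^ n) ^ k) =
          U * (qcoef \<kappa> q q b k * (qfall q m k * (1 - q ^ m / q ^ k)) * (q / q ^ m) ^ k)"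
        using qfall_pred[OF q(1), of n k] by (simp add: m_def mult_ac)
      have "A * (qcoef \<kappa> q q b k * qfall q (Suc m) k * (1 / q ^ Suc m) ^ k) =
        B * (qcoef \<kappa> q q b k * qfall q m k * (1 / q ^ m) ^ k) - \<kappa> / q * (qcoef \<kappa> q q b l * qfall q m l * (1 / q ^ m) ^ l)
        - U * (1 - q ^ m) * (qcoef \<kappa> q q b k * qfall q n k * (1 / q ^ n) ^ k)"
        unfolding * using wall_coeff_rec[OF assms(1-4), of m \<kappa> l] Suc unfolding A_def B_def U_def by simp
      from arg_cong[OF this, of complex_of_real] show ?thesis
        using q(1) Suc by (simp add: coeff_qpol)
    qed
  qed
  from arg_cong[OF this, of "\<lambda>p. poly p z"]
  show "of_real (q ^ Suc n * (1 - b * q ^ Suc n)) * p (Suc (Suc n)) =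
      (of_real (q ^ Suc n * (1 - b * q ^ Suc n) + b * q ^ Suc n * (1 - q ^ Suc n) / q) - of_real (\<kappa> / q) * z) * p (Suc n)
      - of_real (b * q ^ Suc n / q * (1 - q ^ Suc n)) * p n"
    unfolding p_def A_def B_def U_def m_def by (simp only: poly_smult poly_diff poly_pCons) (simp add: algebra_simps)
qed

lemma qpol_root_real:
  fixes q b \<kappa> \<theta> :: real and z :: complex
  assumes q: "0 < q" "q < 1" and b: "0 < b" "b < 1" and \<kappa>: "\<kappa> > 0" and \<theta>: "\<theta> = q \<or> \<theta> = q\<^sup>2"
    and root: "poly (qpol \<kappa> \<theta> q b 1 n) z = 0"
  shows "Im z = 0 \<and> Re z > 0"
proof -
  have pos: "1 - b * q ^ k > 0" "1 - q ^ Suc k > 0" for k using q_factors_pos[OF assms(1-4), of k] by auto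
  have im: "Im z = 0"
  proof (rule ccontr)
    assume nz: "Im z \<noteq> 0"
    have "poly (qpol \<kappa> \<theta> q b 1 n) z \<noteq> 0"
    proof (cases "\<theta> = q")
      case True
      \<comment> \<open>The recurrence relates the rescaled polynomials at one common point. For the
        given degree n this point is \<open>q ^ n * z\<close>, which is nonreal together with
        z.\<close>
      define y where "y = of_real (q ^ n) * z"
      have "poly (qpol \<kappa> q q b (1 / q ^ n) n) y \<noteq> 0"
      proof (rule three_term_nonreal_nonzero[where p = "\<lambda>n. poly (qpol \<kappa> q q b (1 / q ^ n) n) y"
            and A = "\<lambda>n. q ^ n * (1 - b * q ^ n)" and D = "\<lambda>_. \<kappa> / q"
            and B = "\<lambda>n. q ^ n * (1 - b * q ^ n) + b * q ^ n * (1 - q ^ n) / q"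
            and C = "\<lambda>n. b * q ^ n / q * (1 - q ^ n)" and z = y])
        show "Im y \<noteq> 0" using nz q by (simp add: y_def flip: of_real_power)
        show "b * q ^ Suc n / q * (1 - q ^ Suc n) \<ge> 0" for n
          using pos(2)[of n] b q by (intro mult_nonneg_nonneg) auto
        show "q ^ n * (1 - b * q ^ n) > 0" for n using pos(1)[of n] q by simp
      qed (use wall_rec(1)[OF assms(1-4), of \<kappa> y] wall_rec(2)[OF assms(1-4), of _ \<kappa> y] \<kappa> q in \<open>simp_all add: poly_qpol\<close>)
      moreover have "poly (qpol \<kappa> q q b (1 / q ^ n) n) y = poly (qpol \<kappa> q q b 1 n) z"
        using q by (simp add: poly_qpol y_def)
      ultimately show ?thesis using True by simp
    next
      case False
      then have th: "\<theta> = q\<^sup>2" using \<theta> by simp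
      have "poly (qpol \<kappa> (q\<^sup>2) q b 1 n) z \<noteq> 0"
      proof (rule three_term_nonreal_nonzero[where p = "\<lambda>n. poly (qpol \<kappa> (q\<^sup>2) q b 1 n) z"
            and A = "\<lambda>n. 1 - b * q ^ n" and D = "\<lambda>n. \<kappa> * q ^ (2 * n)"
            and B = "\<lambda>n. 1 - q ^ Suc n + q - b * q ^ n"
            and C = "\<lambda>n. q * (1 - q ^ n)" and z = z])
        show "q * (1 - q ^ Suc n) \<ge> 0" for n
          using pos(2)[of n] b q by (intro mult_nonneg_nonneg) auto
        show "of_real (1 - b * q ^ 0) * poly (qpol \<kappa> (q\<^sup>2) q b 1 1) z =
            (of_real (1 - q ^ Suc 0 + q - b * q ^ 0) - of_real (\<kappa> * q ^ (2 * 0)) * z) * poly (qpol \<kappa> (q\<^sup>2) q b 1 0) z"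
          using qlaguerre_rec(1)[OF assms(1-4), of \<kappa> z] by simp
        show "of_real (1 - b * q ^ Suc n) * poly (qpol \<kappa> (q\<^sup>2) q b 1 (Suc (Suc n))) z =
          (of_real (1 - q ^ Suc (Suc n) + q - b * q ^ Suc n) - of_real (\<kappa> * q ^ (2 * Suc n)) * z) * poly (qpol \<kappa> (q\<^sup>2) q b 1 (Suc n)) z
          - of_real (q * (1 - q ^ Suc n)) * poly (qpol \<kappa> (q\<^sup>2) q b 1 n) z" for n
          using qlaguerre_rec(2)[OF assms(1-4), of n \<kappa> z] .
        show "1 - b * q ^ n > 0" for n using pos(1) .
      qed (use \<kappa> q nz in \<open>simp_all add: poly_qpol\<close>)
      then show ?thesis using th by simp
    qed
    then show False using root by simp
  qed
  have "Re z > 0"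
  proof (rule ccontr)
    assume "\<not> Re z > 0"
    then obtain t where t: "t \<ge> 0" "z = - of_real t" using im by (metis complex_eq_iff uminus_complex.sel Im_complex_of_real Re_complex_of_real minus_zero neg_0_le_iff_le not_less minus_minus)
    have "qcoef \<kappa> \<theta> q b k * (-1) ^ k \<ge> 0" for k
    proof -
      have "qcoef \<kappa> \<theta> q b k * (-1) ^ k = (\<Prod>j<k. \<kappa> * \<theta> ^ j / ((1 - q ^ Suc j) * (1 - b * q ^ j)))"
        by (induction k) (auto simp: qcoef_Suc)
      also have "\<dots> \<ge> 0" using pos \<theta> q \<kappa> by (intro prod_nonneg) (auto intro!: divide_nonneg_pos simp del: power_Suc)
      finally show ?thesis .
    qed
    then have nn: "qcoef \<kappa> \<theta> q b k * qfall q n k * (- t) ^ k \<ge> 0" for k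
    proof -
      have "qcoef \<kappa> \<theta> q b k * qfall q n k * (- t) ^ k = (qcoef \<kappa> \<theta> q b k * (-1) ^ k) * (qfall q n k * t ^ k)"
        by (subst power_minus) (simp only: mult_ac)
      also have "\<dots> \<ge> 0" using qfall_bounds[OF q, of n k] t(1) by (intro mult_nonneg_nonneg[OF \<open>qcoef \<kappa> \<theta> q b k * (-1) ^ k \<ge> 0\<close>]) simp
      finally show ?thesis .
    qed
    \<comment> \<open>At a nonpositive argument every term is nonnegative and the term k = 0 equals
      1, hence \<open>S \<ge> 1\<close>.\<close>
    define S where "S = (\<Sum>k\<le>n. qcoef \<kappa> \<theta> q b k * qfall q n k * (- t) ^ k)"
    have "poly (qpol \<kappa> \<theta> q b 1 n) z = of_real S" unfolding poly_qpol t(2) S_def by simp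
    then have "S = 0" using root by simp
    moreover have "S \<ge> (\<Sum>k\<in>{0}. qcoef \<kappa> \<theta> q b k * qfall q n k * (- t) ^ k)"
      unfolding S_def using nn by (intro sum_mono2) auto
    ultimately show False by simp
  qed
  with im show ?thesis by simp
qed

section \<open>Limits of polynomials with positive zeros\<close>

text \<open>The map u / (1 - u) sends the circle of radius r < 1 to a circle symmetric about the
  real axis, with extreme points at u = r and u = - r. Both bounds are attained, which is why the
  resulting radii are exact.\<close>

lemma Re_geometric_bounds:
  fixes u :: complex
  assumes "cmod u < 1"
  shows "Re (u / (1 - u)) \<le> cmod u / (1 - cmod u)" "Re (u / (1 - u)) \<ge> - (cmod u / (1 + cmod u))"
proof -
  define r where "r = cmod u"
  have r: "0 \<le> r" "r < 1" using assms by (auto simp: r_def)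
  have u1: "1 - u \<noteq> 0" using assms by auto
  have e: "u / (1 - u) = 1 / (1 - u) - 1" using u1 by (simp add: field_simps)
  have "Re (1 / (1 - u)) \<le> cmod (1 / (1 - u))" by (rule complex_Re_le_cmod)
  also have "\<dots> \<le> 1 / (1 - r)"
    using norm_triangle_ineq2[of 1 u] r unfolding norm_divide by (simp add: r_def frac_le)
  finally have "Re (u / (1 - u)) \<le> 1 / (1 - r) - 1" unfolding e by simp
  also have "\<dots> = r / (1 - r)" using r by (simp add: field_simps)
  finally show "Re (u / (1 - u)) \<le> cmod u / (1 - cmod u)" by (simp add: r_def)
  have x: "\<bar>Re u\<bar> \<le> r" unfolding r_def by (rule abs_Re_le_cmod)
  have sq: "(Re u)\<^sup>2 + (Im u)\<^sup>2 = r\<^sup>2" by (simp add: r_def cmod_power2)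
  have n: "(cmod (1 - u))\<^sup>2 = 1 - 2 * Re u + r\<^sup>2" unfolding cmod_power2 sq[symmetric] by (simp add: power2_eq_square algebra_simps)
  have "(cmod (1 - u))\<^sup>2 > 0" using u1 by simp
  \<comment> \<open>The difference of the two sides is (r + Re u) (1 - r).\<close>
  moreover have "1 - 2 * Re u + r\<^sup>2 \<le> (1 - Re u) * (1 + r)"
  proof -
    have "(r + Re u) * (1 - r) \<ge> 0" using x r by (intro mult_nonneg_nonneg) auto
    then show ?thesis by (simp add: algebra_simps power2_eq_square)
  qed
  moreover have "1 / (1 + r) \<le> (1 - Re u) / N" if "N > 0" "N \<le> (1 - Re u) * (1 + r)" for N
    using that r by (simp add: divide_simps mult.commute)
  ultimately have "1 / (1 + r) \<le> (1 - Re u) / (cmod (1 - u))\<^sup>2" using n by simp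
  also have "\<dots> = Re (1 / (1 - u))" by (simp add: Re_divide cmod_power2)
  finally have "Re (u / (1 - u)) \<ge> 1 / (1 + r) - 1" unfolding e by simp
  moreover have "1 / (1 + r) - 1 = - (r / (1 + r))" using r by (simp add: field_simps)
  ultimately show "Re (u / (1 - u)) \<ge> - (cmod u / (1 + cmod u))" by (simp add: r_def)
qed

text \<open>Convergence is assumed on every disc, as \<open>R\<close> is arbitrary. The condition
  \<open>second\<close> fails exactly for the second-order Taylor data of an exponential exp (c
  z).\<close>

locale positive_root_limit =
  fixes P :: "complex \<Rightarrow> complex" and a :: "nat \<Rightarrow> nat \<Rightarrow> real" and m :: "nat \<Rightarrow> nat"
  assumes a_pos: "a n i > 0"
    and lim: "uniform_limit (ball 0 R) (\<lambda>n z. \<Prod>i<m n. 1 - of_real (a n i) * z) P sequentially"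
    and second: "deriv (deriv P) 0 \<noteq> (deriv P 0)\<^sup>2"
begin

definition \<Psi> :: "nat \<Rightarrow> complex \<Rightarrow> complex" where
  "\<Psi> n z = (\<Prod>i<m n. 1 - of_real (a n i) * z)"

definition L :: "nat \<Rightarrow> complex \<Rightarrow> complex" where
  "L n z = (\<Sum>i<m n. of_real (a n i) / (1 - of_real (a n i) * z))"

definition LP :: "complex \<Rightarrow> complex" where
  "LP z = - deriv P z / P z"

lemma ulim: "uniform_limit (ball 0 R) \<Psi> P sequentially"
  using lim unfolding \<Psi>_def[abs_def] .

lemma \<Psi>_holomorphic: "\<Psi> n holomorphic_on S"
  unfolding \<Psi>_def[abs_def] by (intro holomorphic_intros)

lemma P_holomorphic: "P holomorphic_on S"
proof -
  have "P holomorphic_on UNIV"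
  proof (rule holomorphic_uniform_sequence[of UNIV \<Psi>])
    fix x :: complex
    have "uniform_limit (cball x 1) \<Psi> P sequentially"
    proof (rule uniform_limit_on_subset[OF ulim[of "cmod x + 2"]], rule subsetI)
      fix y assume "y \<in> cball x 1"
      then show "y \<in> ball 0 (cmod x + 2)" using norm_triangle_sub[of y x] by (simp add: dist_norm norm_minus_commute)
    qed
    then show "\<exists>d>0. cball x d \<subseteq> UNIV \<and> uniform_limit (cball x d) \<Psi> P sequentially" by (intro exI[of _ 1]) auto
  qed (use \<Psi>_holomorphic in auto)
  then show ?thesis by (rule holomorphic_on_subset) simp
qed

lemma P_continuous: "continuous_on S P"
  by (rule holomorphic_on_imp_continuous_on[OF P_holomorphic])

lemma \<Psi>_tendsto: "(\<lambda>n. \<Psi> n z) \<longlonglongrightarrow> P z"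
  by (rule tendsto_uniform_limitI[OF ulim[of "cmod z + 1"]]) auto

lemma deriv_\<Psi>_tendsto: "(\<lambda>n. deriv (\<Psi> n) z) \<longlonglongrightarrow> deriv P z"
  by (rule deriv_complex_uniform_limit[OF ulim[of "cmod z + 1"]]) (use \<Psi>_holomorphic in auto)

lemma P_0 [simp]: "P 0 = 1"
  using \<Psi>_tendsto[of 0] by (simp add: \<Psi>_def LIMSEQ_const_iff)

lemma \<Psi>_eq_0_iff: "\<Psi> n z = 0 \<longleftrightarrow> (\<exists>i<m n. 1 - of_real (a n i) * z = 0)"
  by (auto simp: \<Psi>_def)

lemma deriv_\<Psi>: assumes "\<Psi> n z \<noteq> 0" shows "deriv (\<Psi> n) z = - L n z * \<Psi> n z"
proof -
  have "(\<Psi> n has_field_derivative (\<Psi> n z * (\<Sum>i<m n. - of_real (a n i) / (1 - of_real (a n i) * z)))) (at z)"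
    unfolding \<Psi>_def[abs_def]
    by (rule has_field_derivative_prod') (use assms in \<open>auto simp: \<Psi>_eq_0_iff intro!: derivative_eq_intros\<close>)
  then show ?thesis by (simp add: DERIV_imp_deriv L_def sum_negf mult.commute)
qed

text \<open>Pointwise convergence away from the zeros of \<open>P\<close>; this suffices for all
  later estimates, which are proved for each large n and then passed to the limit.\<close>

lemma L_tendsto: assumes "P z \<noteq> 0" shows "(\<lambda>n. L n z) \<longlonglongrightarrow> LP z"
proof -
  have "(\<lambda>n. - deriv (\<Psi> n) z / \<Psi> n z) \<longlonglongrightarrow> LP z"
    unfolding LP_def by (intro tendsto_intros deriv_\<Psi>_tendsto \<Psi>_tendsto assms)
  moreover have "\<forall>\<^sub>F n in sequentially. \<Psi> n z \<noteq> 0"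
    by (rule tendsto_imp_eventually_ne[OF \<Psi>_tendsto assms])
  then have "\<forall>\<^sub>F n in sequentially. - deriv (\<Psi> n) z / \<Psi> n z = L n z"
    by eventually_elim (simp add: deriv_\<Psi>)
  ultimately show ?thesis by (rule Lim_transform_eventually)
qed

text \<open>On the compact segment |P| has a positive minimum \<open>\<delta>\<close>. A zero 1 /
  \<open>a n i\<close> in the segment would make |P| there equal to the distance between
  \<open>\<Psi> n\<close> and \<open>P\<close>, which is eventually below
  \<open>\<delta>\<close>.\<close>

lemma eventually_a_bound:
  assumes R: "R > 0" and nz: "\<And>t. 0 \<le> t \<Longrightarrow> t \<le> R \<Longrightarrow> P (of_real t) \<noteq> 0"
  shows "\<forall>\<^sub>F n in sequentially. \<forall>i<m n. a n i * R < 1"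
proof -
  have "continuous_on {0..R} (\<lambda>t. cmod (P (of_real t)))"
    by (intro continuous_on_norm continuous_on_compose2[OF P_continuous[of UNIV]] continuous_intros) auto
  then obtain t0 where t0: "t0 \<in> {0..R}" "\<And>t. t \<in> {0..R} \<Longrightarrow> cmod (P (of_real t0)) \<le> cmod (P (of_real t))"
    using continuous_attains_inf[of "{0..R}" "\<lambda>t. cmod (P (of_real t))"] R by auto
  define \<delta> where "\<delta> = cmod (P (of_real t0))"
  have "\<delta> > 0" using t0(1) nz by (auto simp: \<delta>_def)
  with ulim[of "R + 1"] have "\<forall>\<^sub>F n in sequentially. \<forall>z\<in>ball 0 (R + 1). dist (\<Psi> n z) (P z) < \<delta>"
    by (rule uniform_limitD)
  then show ?thesis
  proof eventually_elim
    case (elim n)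
    show ?case
    proof (intro allI impI, rule ccontr)
      fix i assume i: "i < m n" "\<not> a n i * R < 1"
      define t where "t = 1 / a n i"
      have t: "0 \<le> t" "t \<le> R" using a_pos[of n i] i(2) by (auto simp: t_def field_simps)
      have "\<Psi> n (of_real t) = 0" unfolding \<Psi>_eq_0_iff using i(1) a_pos[of n i] by (intro exI[of _ i]) (simp add: t_def)
      moreover have "dist (\<Psi> n (of_real t)) (P (of_real t)) < \<delta>" using elim t by auto
      ultimately have "cmod (P (of_real t)) < \<delta>" by simp
      then show False using t0(2)[of t] t by (simp add: \<delta>_def)
    qed
  qed
qed

text \<open>Hurwitz's theorem along the increasing enumeration of the infinitely many good indices.
  The weak form with "frequently" is chosen for its contrapositive: a zero of \<open>P\<close> in
  the disc forces polynomial zeros there for all but finitely many n.\<close>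

lemma Hurwitz_frequently:
  assumes R: "R > 0" and fr: "\<exists>\<^sub>F n in sequentially. \<forall>i<m n. a n i * R \<le> 1" and z: "cmod z < R"
  shows "P z \<noteq> 0"
proof (cases "P constant_on ball 0 R")
  case True
  moreover have "0 \<in> ball (0::complex) R" "z \<in> ball 0 R" using R z by auto
  ultimately have "P z = P 0" unfolding constant_on_def by metis
  then show ?thesis by simp
next
  case False
  define Q where "Q = {n. \<forall>i<m n. a n i * R \<le> 1}"
  have "infinite Q" using fr unfolding Q_def cofinite_eq_sequentially[symmetric] frequently_cofinite .
  define r where "r = enumerate Q"
  have r: "strict_mono r" "r n \<in> Q" for n
    using \<open>infinite Q\<close> by (auto simp: r_def strict_mono_enumerate enumerate_in_set)
  show ?thesis
  proof (rule Hurwitz_no_zeros[of "ball 0 R" "\<lambda>n. \<Psi> (r n)" P])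
    fix K :: "complex set" assume K: "compact K" "K \<subseteq> ball 0 R"
    have "uniform_limit K \<Psi> P sequentially" by (rule uniform_limit_on_subset[OF ulim K(2)])
    then show "uniform_limit K (\<lambda>n. \<Psi> (r n)) P sequentially"
      by (rule filterlim_compose) (rule filterlim_subseq[OF r(1)])
  next
    fix n and w :: complex assume w: "w \<in> ball 0 R"
    show "\<Psi> (r n) w \<noteq> 0"
    proof
      assume "\<Psi> (r n) w = 0"
      then obtain i where i: "i < m (r n)" "of_real (a (r n) i) * w = 1" unfolding \<Psi>_eq_0_iff by auto
      from arg_cong[OF i(2), of cmod] have "a (r n) i * cmod w = 1" using a_pos[of "r n" i] by (simp add: norm_mult)
      moreover have "a (r n) i * cmod w < a (r n) i * R" using w a_pos[of "r n" i] by simp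
      ultimately show False using r(2)[of n] i(1) unfolding Q_def by fastforce
    qed
  qed (use \<Psi>_holomorphic P_holomorphic False z in auto)
qed

text \<open>Without a positive zero the \<open>a n i\<close> tend to \<open>0\<close> uniformly in \<open>i\<close>, so the logarithmic derivative
  would be constant and \<open>P\<close> an exponential function, contrary to the assumption \<open>second\<close>.\<close>

lemma exists_positive_zero: "\<exists>t>0. P (of_real t) = 0"
proof (rule ccontr)
  assume "\<not> ?thesis"
  then have nz: "P (of_real t) \<noteq> 0" if "t \<ge> 0" for t using that by (cases "t = 0") auto
  have ev: "\<forall>\<^sub>F n in sequentially. \<forall>i<m n. a n i * R < 1" if "R > 0" for R
    using eventually_a_bound that nz by blast
  have nz2: "P z \<noteq> 0" for z
  proof (rule Hurwitz_frequently[of "cmod z + 1"])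
    show "\<exists>\<^sub>F n in sequentially. \<forall>i<m n. a n i * (cmod z + 1) \<le> 1"
      by (rule eventually_frequently) (use ev[of "cmod z + 1"] in \<open>auto elim!: eventually_mono intro: less_imp_le simp: add_nonneg_pos\<close>)
  qed (auto simp: add_nonneg_pos)
  have LP_const: "LP z = LP 0" if z: "cmod z < 1" for z
  proof -
    \<comment> \<open>With b = \<open>a n i\<close> < 1 / R and |z| < 1, the term differs from b by
      b |b z| / |1 - b z|. Here |b z| is at most 1 / R, and R at least 2 keeps the denominator above
      1 / 2. The bounds 2 b / R add up to 2 / R times \<open>L n 0\<close>, and finally R tends to
      infinity.\<close>
    have bound: "cmod (LP z - LP 0) \<le> 2 / R * cmod (LP 0)" if R: "R \<ge> 2" for R
    proof -
      have "\<forall>\<^sub>F n in sequentially. \<forall>i<m n. a n i * R < 1" by (rule ev) (use R in simp)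
      then have "\<forall>\<^sub>F n in sequentially. cmod (L n z - L n 0) \<le> 2 / R * cmod (L n 0)"
      proof eventually_elim
        case (elim n)
        have tb: "cmod (of_real (a n i) / (1 - of_real (a n i) * z) - of_real (a n i)) \<le> 2 / R * a n i" if i: "i < m n" for i
        proof -
          define b where "b = a n i"
          have b: "0 < b" "b * R < 1" using a_pos elim i by (auto simp: b_def)
          have "b * 2 \<le> b * R" using b R by simp
          then have b2: "b < 1 / 2" using b by linarith
          have bR: "b \<le> 1 / R" using b R by (simp add: field_simps)
          have "cmod (of_real b * z) \<le> b * 1" using z b unfolding norm_mult by (intro mult_mono) auto
          then have c: "cmod (1 - of_real b * z) \<ge> 1 / 2" using norm_triangle_ineq2[of 1 "of_real b * z"] b2 by simp
          then have "1 - of_real b * z \<noteq> 0" by auto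
          then have "of_real b / (1 - of_real b * z) - of_real b = of_real b * (of_real b * z) / (1 - of_real b * z)"
            by (simp add: field_simps)
          then have "cmod (of_real b / (1 - of_real b * z) - of_real b) = b * (b * cmod z) / cmod (1 - of_real b * z)"
            using b by (simp add: norm_mult norm_divide)
          also have "\<dots> \<le> b * (1 / R * 1) / (1 / 2)"
            using b bR z c R by (intro frac_le mult_left_mono mult_mono) auto
          finally show ?thesis by (simp add: b_def field_simps)
        qed
        have "cmod (L n z - L n 0) = cmod (\<Sum>i<m n. of_real (a n i) / (1 - of_real (a n i) * z) - of_real (a n i))"
          by (simp add: L_def sum_subtractf)
        also have "\<dots> \<le> (\<Sum>i<m n. 2 / R * a n i)" using tb by (intro sum_norm_le) auto
        also have "\<dots> = 2 / R * (\<Sum>i<m n. a n i)" by (simp add: sum_distrib_left)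
        also have "(\<Sum>i<m n. a n i) = cmod (L n 0)"
        proof -
          have "L n 0 = of_real (\<Sum>i<m n. a n i)" by (simp add: L_def)
          then show ?thesis using a_pos by (simp only: norm_of_real) (simp add: sum_nonneg less_imp_le)
        qed
        finally show ?case .
      qed
      moreover have "(\<lambda>n. cmod (L n z - L n 0)) \<longlonglongrightarrow> cmod (LP z - LP 0)"
        by (intro tendsto_intros L_tendsto nz2)
      moreover have "(\<lambda>n. 2 / R * cmod (L n 0)) \<longlonglongrightarrow> 2 / R * cmod (LP 0)"
        by (intro tendsto_intros L_tendsto nz2)
      ultimately show ?thesis by (intro tendsto_le[OF sequentially_bot])
    qed
    have "((\<lambda>R. 2 / R * cmod (LP 0)) \<longlongrightarrow> 0) at_top"
      by (intro tendsto_mult_left_zero tendsto_divide_0[OF tendsto_const] filterlim_at_top_imp_at_infinity filterlim_ident)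
    moreover have "\<forall>\<^sub>F R in at_top. cmod (LP z - LP 0) \<le> 2 / R * cmod (LP 0)"
      using eventually_ge_at_top[of "2::real"] by eventually_elim (rule bound)
    ultimately have "cmod (LP z - LP 0) \<le> 0" by (rule tendsto_lowerbound) simp
    then show ?thesis by simp
  qed
  have dP: "deriv P z = deriv P 0 * P z" if "cmod z < 1" for z
    using LP_const[OF that] nz2[of z] by (simp add: LP_def field_simps)
  \<comment> \<open>Near 0, \<open>P\<close> solves P' = P'(0) P; one more differentiation at 0
    contradicts \<open>second\<close>.\<close>
  have "deriv (deriv P) 0 = deriv (\<lambda>z. deriv P 0 * P z) 0"
  proof (rule deriv_cong_ev)
    have "\<forall>\<^sub>F z in nhds 0. z \<in> ball (0::complex) 1" by (rule eventually_nhds_in_open) auto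
    then show "\<forall>\<^sub>F z in nhds 0. deriv P z = deriv P 0 * P z" by eventually_elim (rule dP, simp)
  qed simp
  also have "\<dots> = deriv P 0 * deriv P 0"
    using P_holomorphic[of UNIV] by (intro deriv_cmult) (auto simp: holomorphic_on_def field_differentiable_at_within)
  finally show False using second by (simp add: power2_eq_square)
qed

text \<open>Admitting t = 0 makes the set of zeros closed, so that the infimum is attained; 0 itself
  is excluded by \<open>P_0\<close>.\<close>

definition w1 :: real where
  "w1 = Inf {t. t \<ge> 0 \<and> P (of_real t) = 0}"

lemma w1: "w1 > 0" "P (of_real w1) = 0" "0 \<le> t \<Longrightarrow> t < w1 \<Longrightarrow> P (of_real t) \<noteq> 0"
proof -
  define Z where "Z = {t. t \<ge> 0 \<and> P (of_real t) = 0}"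
  have "closed ({0..} \<inter> (\<lambda>t. P (of_real t)) -` {0})"
    by (intro continuous_closed_preimage continuous_on_compose2[OF P_continuous[of UNIV]] continuous_intros) auto
  moreover have "{0..} \<inter> (\<lambda>t. P (of_real t)) -` {0} = Z" by (auto simp: Z_def)
  ultimately have "closed Z" by simp
  moreover have "Z \<noteq> {}" using exists_positive_zero by (auto simp: Z_def intro: less_imp_le)
  moreover have bdd: "bdd_below Z" by (auto simp: Z_def bdd_below_def)
  ultimately have "w1 \<in> Z" unfolding w1_def Z_def[symmetric] by (intro closed_contains_Inf)
  then show w1: "P (of_real w1) = 0" and "w1 > 0"
    using P_0 by (auto simp: Z_def less_le)
  show "P (of_real t) \<noteq> 0" if "0 \<le> t" "t < w1" for t
  proof
    assume "P (of_real t) = 0"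
    then have "t \<in> Z" using that by (simp add: Z_def)
    then have "w1 \<le> t" unfolding w1_def Z_def[symmetric] using bdd by (rule cInf_lower)
    then show False using that by simp
  qed
qed

lemma eventually_a_bound_w1: "R < w1 \<Longrightarrow> \<forall>\<^sub>F n in sequentially. \<forall>i<m n. a n i * R < 1"
proof (cases "R > 0")
  case False
  then have "a n i * R < 1" for n i
    using mult_nonneg_nonpos[of "a n i" R] a_pos[of n i] by simp
  then show ?thesis by simp
qed (use eventually_a_bound w1 in auto)

text \<open>The zeros of the polynomials all lie on the positive axis, so their absence from a
  segment [0, R] means absence from the whole disc, and Hurwitz transfers this to \<open>P\<close>.
  Thus \<open>w1\<close> is minimal in modulus among all zeros.\<close>

lemma P_nonzero: assumes "cmod z < w1" shows "P z \<noteq> 0"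
proof -
  define R where "R = (cmod z + w1) / 2"
  have R: "cmod z < R" "R < w1" "R > 0" using assms w1(1) by (auto simp: R_def add_nonneg_pos)
  show ?thesis
    by (rule Hurwitz_frequently[OF R(3) _ R(1)], rule eventually_frequently)
      (use eventually_a_bound_w1[OF R(2)] in \<open>auto elim!: eventually_mono intro: less_imp_le\<close>)
qed

text \<open>Every factor is at least 1 on the negative axis, hence so is the limit. This reaches
  beyond the disc of radius \<open>w1\<close>, as the equation on the imaginary axis
  requires.\<close>

lemma P_neg_nonzero: assumes "t \<le> 0" shows "P (of_real t) \<noteq> 0"
proof -
  have e: "\<Psi> n (of_real t) = of_real (\<Prod>i<m n. 1 - a n i * t)" for n by (simp add: \<Psi>_def)
  have "(\<Prod>i<m n. 1 - a n i * t) \<ge> 1" for n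
    using assms a_pos by (intro prod_ge_1) (simp add: mult_nonneg_nonpos less_imp_le)
  then have "1 \<le> Re (\<Psi> n (of_real t))" for n unfolding e Re_complex_of_real .
  moreover have "(\<lambda>n. Re (\<Psi> n (of_real t))) \<longlonglongrightarrow> Re (P (of_real t))" by (intro tendsto_intros \<Psi>_tendsto)
  ultimately have "1 \<le> Re (P (of_real t))" by (intro tendsto_lowerbound[OF _ _ sequentially_bot]) auto
  then show ?thesis by auto
qed

lemma P_real_nonzero: "t < w1 \<Longrightarrow> P (of_real t) \<noteq> 0"
  using P_neg_nonzero w1(3) by (cases "t \<le> 0") auto

section \<open>The logarithmic derivative on the real axis\<close>

lemma L_of_real: "L n (of_real t) = of_real (\<Sum>i<m n. a n i / (1 - a n i * t))"
  by (simp add: L_def)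

definition Lr :: "real \<Rightarrow> real" where
  "Lr t = Re (LP (of_real t))"

lemma L_real_tendsto: "t < w1 \<Longrightarrow> (\<lambda>n. \<Sum>i<m n. a n i / (1 - a n i * t)) \<longlonglongrightarrow> Lr t"
  using tendsto_Re[OF L_tendsto[OF P_real_nonzero, of t]] unfolding L_of_real Lr_def by simp

lemma LP_of_real: assumes "t < w1" shows "LP (of_real t) = of_real (Lr t)"
proof -
  have "(\<lambda>n. Im (L n (of_real t))) \<longlonglongrightarrow> Im (LP (of_real t))"
    by (intro tendsto_intros L_tendsto P_real_nonzero assms)
  then have "Im (LP (of_real t)) = 0" unfolding L_of_real by (simp add: LIMSEQ_const_iff)
  then show ?thesis by (simp add: Lr_def complex_eq_iff)
qed

lemma
  assumes z: "cmod z < w1"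
  shows Re_LP_upper: "Re (z * LP z) \<le> cmod z * Lr (cmod z)"
    and Re_LP_lower: "Re (z * LP z) \<ge> - (cmod z * Lr (- cmod z))"
proof -
  have ev: "\<forall>\<^sub>F n in sequentially. \<forall>i<m n. a n i * cmod z < 1" by (rule eventually_a_bound_w1[OF z])
  have eq: "z * L n z = (\<Sum>i<m n. (of_real (a n i) * z) / (1 - of_real (a n i) * z))" for n
    by (simp add: L_def sum_distrib_left mult.commute)
  have lz: "(\<lambda>n. Re (z * L n z)) \<longlonglongrightarrow> Re (z * LP z)"
    by (intro tendsto_intros L_tendsto P_nonzero z)
  have nrm: "cmod (of_real (a n i) * z) = a n i * cmod z" for n i using a_pos[of n i] by (simp add: norm_mult)
  from ev have "\<forall>\<^sub>F n in sequentially. Re (z * L n z) \<le> cmod z * (\<Sum>i<m n. a n i / (1 - a n i * cmod z))"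
  proof eventually_elim
    case (elim n)
    have "Re (z * L n z) = (\<Sum>i<m n. Re (of_real (a n i) * z / (1 - of_real (a n i) * z)))" by (simp only: eq Re_sum)
    also have "\<dots> \<le> (\<Sum>i<m n. (a n i * cmod z) / (1 - (a n i * cmod z)))"
    proof (rule sum_mono)
      fix i assume "i \<in> {..<m n}"
      then show "Re (of_real (a n i) * z / (1 - of_real (a n i) * z)) \<le> a n i * cmod z / (1 - a n i * cmod z)"
        using Re_geometric_bounds(1)[of "of_real (a n i) * z", unfolded nrm] elim by simp
    qed
    finally show ?case by (simp add: sum_distrib_left mult.commute)
  qed
  then show "Re (z * LP z) \<le> cmod z * Lr (cmod z)"
    by (rule tendsto_le[OF sequentially_bot _ lz, rotated]) (intro tendsto_intros L_real_tendsto z)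
  from ev have "\<forall>\<^sub>F n in sequentially. - (cmod z * (\<Sum>i<m n. a n i / (1 - a n i * - cmod z))) \<le> Re (z * L n z)"
  proof eventually_elim
    case (elim n)
    have "- (cmod z * (\<Sum>i<m n. a n i / (1 - a n i * - cmod z))) = (\<Sum>i<m n. - (a n i * cmod z / (1 + a n i * cmod z)))"
      by (simp add: sum_distrib_left sum_negf mult.commute)
    also have "\<dots> \<le> (\<Sum>i<m n. Re (of_real (a n i) * z / (1 - of_real (a n i) * z)))"
    proof (rule sum_mono)
      fix i assume "i \<in> {..<m n}"
      then show "- (a n i * cmod z / (1 + a n i * cmod z)) \<le> Re (of_real (a n i) * z / (1 - of_real (a n i) * z))"
        using Re_geometric_bounds(2)[of "of_real (a n i) * z", unfolded nrm] elim by simp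
    qed
    also have "\<dots> = Re (z * L n z)" by (simp only: eq Re_sum)
    finally show ?case .
  qed
  then show "Re (z * LP z) \<ge> - (cmod z * Lr (- cmod z))"
    by (rule tendsto_le[OF sequentially_bot lz, rotated])
      (intro tendsto_intros L_real_tendsto order.strict_trans1[OF _ w1(1)], simp)
qed

text \<open>By Hurwitz, infinitely many of the polynomials have a zero below any \<open>R > w1\<close>; its term in the
  logarithmic derivative alone gives the bound.\<close>

lemma Lr_lower: assumes t: "t < w1" shows "Lr t \<ge> 1 / (w1 - t)"
proof -
  have R: "Lr t \<ge> 1 / (R - t)" if R: "R > w1" for R
  proof (rule ccontr)
    assume "\<not> ?thesis"
    then have "\<forall>\<^sub>F n in sequentially. (\<Sum>i<m n. a n i / (1 - a n i * t)) < 1 / (R - t)"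
      using order_tendstoD(2)[OF L_real_tendsto[OF t]] by simp
    \<comment> \<open>\<open>w1\<close> is itself a zero in the open disc of radius R, so the
      hypothesis of \<open>Hurwitz_frequently\<close> must fail.\<close>
    moreover have "\<not> (\<exists>\<^sub>F n in sequentially. \<forall>i<m n. a n i * R \<le> 1)"
      using Hurwitz_frequently[of R "of_real w1"] w1 R by auto
    then have "\<forall>\<^sub>F n in sequentially. \<exists>i<m n. a n i * R > 1"
      unfolding not_frequently by (auto elim!: eventually_mono simp: not_le)
    moreover have "\<forall>\<^sub>F n in sequentially. \<forall>i<m n. a n i * t < 1" by (rule eventually_a_bound_w1[OF t])
    ultimately have "\<forall>\<^sub>F n in sequentially. False"
    proof eventually_elim
      case (elim n)
      then obtain i where i: "i < m n" "a n i * R > 1" by blast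
      have at: "a n i * t < 1" using elim i by auto
      \<comment> \<open>Both denominators are positive, and clearing them leaves
        \<open>1 \<le> a n i * R\<close>.\<close>
      have "1 / (R - t) \<le> a n i / (1 - a n i * t)" using i(2) at R t by (simp add: field_simps)
      also have "\<dots> = (\<Sum>i\<in>{i}. a n i / (1 - a n i * t))" by simp
      also have "\<dots> \<le> (\<Sum>i<m n. a n i / (1 - a n i * t))"
      proof (rule sum_mono2)
        show "0 \<le> a n j / (1 - a n j * t)" if "j \<in> {..<m n} - {i}" for j
          using a_pos[of n j] elim that by (simp add: less_imp_le)
      qed (use i in auto)
      finally show ?case using elim by simp
    qed
    then show False by simp
  qed
  have "((\<lambda>R. 1 / (R - t)) \<longlongrightarrow> 1 / (w1 - t)) (at_right w1)"
    using t by (intro tendsto_intros) auto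
  moreover have "\<forall>\<^sub>F R in at_right w1. 1 / (R - t) \<le> Lr t"
    using eventually_at_right_less by eventually_elim (rule R)
  ultimately show ?thesis by (rule tendsto_upperbound) simp
qed

text \<open>Each a r / (1 + a r) increases strictly in r, but strictness could be lost in the limit.
  The increment is (s - r) / (1 + a s) times a / (1 + a r). Since zeros eventually exceed
  \<open>w1 / 2\<close>, all a are at most M = 2 / \<open>w1\<close>, so the sum of increments is at
  least the fixed positive multiple (s - r) / (1 + M s) of the sum tending to
  \<open>Lr (- r)\<close>.\<close>

lemma Lr_neg_strict_mono:
  assumes rs: "0 \<le> r" "r < s" shows "r * Lr (- r) < s * Lr (- s)"
proof -
  have w: "- r < w1" "- s < w1" using rs w1(1) by auto
  define M where "M = 2 / w1"
  have M: "M > 0" using w1(1) by (simp add: M_def)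
  have "\<forall>\<^sub>F n in sequentially. \<forall>i<m n. a n i * (w1 / 2) < 1" by (rule eventually_a_bound_w1) (use w1(1) in simp)
  then have "\<forall>\<^sub>F n in sequentially. (s - r) / (1 + M * s) * (\<Sum>i<m n. a n i / (1 - a n i * - r)) \<le>
    s * (\<Sum>i<m n. a n i / (1 - a n i * - s)) - r * (\<Sum>i<m n. a n i / (1 - a n i * - r))"
  proof eventually_elim
    case (elim n)
    have "(s - r) / (1 + M * s) * (\<Sum>i<m n. a n i / (1 - a n i * - r)) = (\<Sum>i<m n. (s - r) / (1 + M * s) * (a n i / (1 + a n i * r)))"
      by (simp add: sum_distrib_left)
    also have "\<dots> \<le> (\<Sum>i<m n. s * (a n i / (1 + a n i * s)) - r * (a n i / (1 + a n i * r)))"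
    proof (rule sum_mono)
      fix i assume "i \<in> {..<m n}"
      define b where "b = a n i"
      have b: "b > 0" "b \<le> M" using elim \<open>i \<in> _\<close> a_pos[of n i] w1(1) by (auto simp: b_def M_def field_simps intro: less_imp_le)
      have d: "1 + b * s > 0" "1 + b * r > 0" "1 + M * s > 0" using b rs M by (auto intro!: add_pos_nonneg)
      have "(s - r) / (1 + M * s) * (b / (1 + b * r)) \<le> (s - r) / (1 + b * s) * (b / (1 + b * r))"
        using b rs d by (intro mult_right_mono frac_le) (auto intro: mult_right_mono)
      also have "\<dots> = s * (b / (1 + b * s)) - r * (b / (1 + b * r))"
        using d by (simp add: divide_simps) (simp add: algebra_simps)
      finally show "(s - r) / (1 + M * s) * (a n i / (1 + a n i * r)) \<le> s * (a n i / (1 + a n i * s)) - r * (a n i / (1 + a n i * r))"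
        by (simp add: b_def)
    qed
    also have "\<dots> = s * (\<Sum>i<m n. a n i / (1 - a n i * - s)) - r * (\<Sum>i<m n. a n i / (1 - a n i * - r))"
      by (simp add: sum_distrib_left sum_subtractf)
    finally show ?case .
  qed
  then have "(s - r) / (1 + M * s) * Lr (- r) \<le> s * Lr (- s) - r * Lr (- r)"
    by (rule tendsto_le[OF sequentially_bot, rotated 2]) (intro tendsto_intros L_real_tendsto w)+
  moreover have "Lr (- r) > 0"
    using Lr_lower[OF w(1)] w(1) by (auto intro: less_le_trans[rotated])
  then have "(s - r) / (1 + M * s) * Lr (- r) > 0"
    using rs M by (intro mult_pos_pos divide_pos_pos add_pos_nonneg) auto
  ultimately show ?thesis by simp
qed

section \<open>Solving the real equations for the critical radius\<close>

lemma deriv_P_continuous: "continuous_on S (deriv P)"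
  by (rule holomorphic_on_imp_continuous_on, rule holomorphic_on_subset[OF holomorphic_deriv[OF P_holomorphic open_UNIV]]) simp

lemma Lr_continuous: "S \<subseteq> {..<w1} \<Longrightarrow> continuous_on S Lr"
  unfolding Lr_def[abs_def] LP_def
  by (intro continuous_intros continuous_on_compose2[OF P_continuous[of UNIV]]
      continuous_on_compose2[OF deriv_P_continuous[of UNIV]]) (auto intro!: P_real_nonzero)

lemma smallest_root:
  assumes c: "c > 0" and k: "k > 0"
  obtains x where "0 < x" "x < w1" "c * (x * Lr x) = k" "\<And>t. 0 \<le> t \<Longrightarrow> t < x \<Longrightarrow> c * (t * Lr t) < k"
proof -
  \<comment> \<open>The solution of c t / (w1 - t) = k, so that the lower bound of
    \<open>Lr_lower\<close> already reaches k at \<open>t0\<close>.\<close>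
  define t0 where "t0 = w1 * k / (c + k)"
  have t0: "0 \<le> t0" "t0 < w1" using c k w1(1) by (auto simp: t0_def field_simps)
  have "w1 - t0 = w1 * c / (c + k)" using c k by (simp add: t0_def field_simps)
  then have "c * (t0 * (1 / (w1 - t0))) = k" using c k w1(1) by (simp add: t0_def)
  moreover have "c * (t0 * (1 / (w1 - t0))) \<le> c * (t0 * Lr t0)"
    using Lr_lower[OF t0(2)] t0 c by (intro mult_left_mono) auto
  ultimately have ge: "c * (t0 * Lr t0) \<ge> k" by simp
  define S where "S = {0..t0} \<inter> (\<lambda>t. c * (t * Lr t)) -` {k..}"
  have cont: "continuous_on {0..t0} (\<lambda>t. c * (t * Lr t))"
    using t0 by (intro continuous_intros Lr_continuous) auto
  have "closed S" unfolding S_def by (intro continuous_closed_preimage cont) auto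
  moreover have "bounded S" by (rule bounded_subset[of "{0..t0}"]) (auto simp: S_def)
  ultimately have "compact S" by (simp add: compact_eq_bounded_closed)
  moreover have "S \<noteq> {}" using ge t0 by (auto simp: S_def)
  ultimately obtain x where x: "x \<in> S" "\<And>y. y \<in> S \<Longrightarrow> x \<le> y" using compact_attains_inf by metis
  have x0: "0 \<le> x" "x \<le> t0" "c * (x * Lr x) \<ge> k" using x(1) by (auto simp: S_def)
  have lt: "c * (t * Lr t) < k" if "0 \<le> t" "t < x" for t
  proof (rule ccontr)
    assume "\<not> ?thesis"
    then have "t \<in> S" using that x0 by (simp add: S_def)
    then show False using x(2)[of t] that by simp
  qed
  have "x \<noteq> 0" using x0(3) k by auto
  \<comment> \<open>Equality holds somewhere in [0, x] and fails strictly below x, the least point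
    of the superlevel set; hence it holds at x.\<close>
  have "\<exists>y\<ge>0. y \<le> x \<and> c * (y * Lr y) = k"
    by (rule IVT') (use x0 k continuous_on_subset[OF cont, of "{0..x}"] in auto)
  then have "c * (x * Lr x) = k" using lt by (metis less_irrefl order_le_less)
  then show ?thesis using that[of x] x0 t0 lt \<open>x \<noteq> 0\<close> by auto
qed

text \<open>At t = \<open>w1\<close> the bound \<open>Lr (- w1) \<ge> 1 / (2 * w1)\<close> makes the
  left side at least c / 2 > k. This is the origin of the factor 2, and it places the root before
  \<open>w1\<close>; monotonicity yields the rest.\<close>

lemma unique_neg_root:
  assumes c: "c > 2 * k" and k: "k > 0"
  obtains x where "0 < x" "x < w1" "c * (x * Lr (- x)) = k" "\<And>t. 0 \<le> t \<Longrightarrow> t < x \<Longrightarrow> c * (t * Lr (- t)) < k"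
    "\<And>t. t > x \<Longrightarrow> c * (t * Lr (- t)) > k"
proof -
  have cpos: "c > 0" using c k by simp
  have "w1 * Lr (- w1) \<ge> w1 * (1 / (w1 - (- w1)))"
    using Lr_lower[of "- w1"] w1(1) by (intro mult_left_mono) auto
  also have "w1 * (1 / (w1 - (- w1))) = 1 / 2" using w1(1) by simp
  finally have "c * (w1 * Lr (- w1)) \<ge> c * (1 / 2)" using cpos by (intro mult_left_mono) auto
  then have gt: "c * (w1 * Lr (- w1)) > k" using c by simp
  have cont: "continuous_on {0..w1} (\<lambda>t. c * (t * Lr (- t)))"
    using w1(1) by (intro continuous_intros continuous_on_compose2[OF Lr_continuous[of "{..<w1}"]]) auto
  have "\<exists>y\<ge>0. y \<le> w1 \<and> c * (y * Lr (- y)) = k"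
    by (rule IVT') (use gt k w1(1) cont in auto)
  then obtain x where x: "0 \<le> x" "x \<le> w1" "c * (x * Lr (- x)) = k" by blast
  have "x \<noteq> 0" "x \<noteq> w1" using x(3) gt k by auto
  moreover have "c * (t * Lr (- t)) < c * (x * Lr (- x))" if "0 \<le> t" "t < x" for t
    using Lr_neg_strict_mono[OF that] cpos by simp
  moreover have "c * (t * Lr (- t)) > c * (x * Lr (- x))" if "t > x" for t
    using Lr_neg_strict_mono[OF x(1) that] cpos by simp
  ultimately show ?thesis using that[of x] x by auto
qed

end

section \<open>The entire functions as limits\<close>

locale qseries =
  fixes q b \<kappa> \<theta> :: real
  assumes q: "0 < q" "q < 1" and b: "0 < b" "b < 1" and \<kappa>: "\<kappa> > 0" and \<theta>: "\<theta> = q \<or> \<theta> = q\<^sup>2"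
begin

definition qser :: "complex \<Rightarrow> complex" where
  "qser w = (\<Sum>k. of_real (qcoef \<kappa> \<theta> q b k) * w ^ k)"

lemma \<theta>_bounds: "0 < \<theta>" "\<theta> < 1" "\<theta> \<le> q"
proof -
  have "q * q < q * 1" using q by (intro mult_strict_left_mono) auto
  moreover have "q * q < 1" using \<open>q * q < q * 1\<close> q by linarith
  ultimately show "0 < \<theta>" "\<theta> < 1" "\<theta> \<le> q" using q \<theta> by (auto simp: power2_eq_square)
qed

text \<open>The ratio of consecutive terms is at most \<open>B * \<theta> ^ k\<close>, which tends
  to 0, so the series converges everywhere.\<close>

lemma qcoef_summable: "summable (\<lambda>k. \<bar>qcoef \<kappa> \<theta> q b k\<bar> * R ^ k)"
proof -
  define B where "B = \<kappa> * \<bar>R\<bar> / ((1 - q) * (1 - b))"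
  have pos: "1 - b * q ^ k > 0" "1 - q ^ Suc k > 0" for k using q_factors_pos[OF q b, of k] by auto
  have "(\<lambda>k. B * \<theta> ^ k) \<longlonglongrightarrow> B * 0"
    using \<theta>_bounds by (intro tendsto_intros LIMSEQ_power_zero) simp
  then have "\<forall>\<^sub>F k in sequentially. B * \<theta> ^ k < 1 / 2" by (intro order_tendstoD(2)) auto
  then obtain N where N: "\<And>k. k \<ge> N \<Longrightarrow> B * \<theta> ^ k < 1 / 2" unfolding eventually_sequentially by blast
  show ?thesis
  proof (rule summable_ratio_test[of "1 / 2" N])
    fix k assume k: "k \<ge> N"
    have "(1 - q) * (1 - b) \<le> (1 - q ^ Suc k) * (1 - b * q ^ k)"
      using q b power_decreasing[of 1 "Suc k" q] mult_left_mono[of "q ^ k" 1 b] power_le_one[of q k] pos[of k]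
      by (intro mult_mono) auto
    then have "\<kappa> * \<theta> ^ k * \<bar>R\<bar> / ((1 - q ^ Suc k) * (1 - b * q ^ k)) \<le> \<kappa> * \<theta> ^ k * \<bar>R\<bar> / ((1 - q) * (1 - b))"
      using q b \<kappa> \<theta>_bounds pos[of k] by (intro divide_left_mono mult_nonneg_nonneg mult_pos_pos) auto
    also have "\<dots> = B * \<theta> ^ k" by (simp add: B_def)
    also have "\<dots> \<le> 1 / 2" using N[OF k] by simp
    finally have *: "\<kappa> * \<theta> ^ k * \<bar>R\<bar> / ((1 - q ^ Suc k) * (1 - b * q ^ k)) \<le> 1 / 2" .
    have "norm (\<bar>qcoef \<kappa> \<theta> q b (Suc k)\<bar> * R ^ Suc k) =
        (\<kappa> * \<theta> ^ k * \<bar>R\<bar> / ((1 - q ^ Suc k) * (1 - b * q ^ k))) * norm (\<bar>qcoef \<kappa> \<theta> q b k\<bar> * R ^ k)"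
      using pos[of k] \<kappa> \<theta>_bounds unfolding qcoef_Suc by (simp add: abs_mult power_abs)
    also have "\<dots> \<le> 1 / 2 * norm (\<bar>qcoef \<kappa> \<theta> q b k\<bar> * R ^ k)" using * by (rule mult_right_mono) simp
    finally show "norm (\<bar>qcoef \<kappa> \<theta> q b (Suc k)\<bar> * R ^ Suc k) \<le> 1 / 2 * norm (\<bar>qcoef \<kappa> \<theta> q b k\<bar> * R ^ k)" .
  qed simp
qed

lemma qser_summable: "summable (\<lambda>k. complex_of_real (qcoef \<kappa> \<theta> q b k) * w ^ k)"
  by (rule summable_norm_cancel) (use qcoef_summable[of "cmod w"] in \<open>simp add: norm_mult norm_power\<close>)

lemma qser_DERIV: "(qser has_field_derivative (\<Sum>k. diffs (\<lambda>k. complex_of_real (qcoef \<kappa> \<theta> q b k)) k * w ^ k)) (at w)"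
  unfolding qser_def[abs_def] by (rule termdiffs_strong_converges_everywhere) (rule qser_summable)

lemma deriv_qser: "deriv qser w = (\<Sum>k. diffs (\<lambda>k. complex_of_real (qcoef \<kappa> \<theta> q b k)) k * w ^ k)"
  using qser_DERIV by (rule DERIV_imp_deriv)

lemma deriv_deriv_qser_0: "deriv (deriv qser) 0 = of_real (2 * qcoef \<kappa> \<theta> q b 2)"
proof -
  define d where "d = diffs (\<lambda>k. complex_of_real (qcoef \<kappa> \<theta> q b k))"
  have "summable (\<lambda>k. d k * w ^ k)" for w unfolding d_def by (rule termdiff_converges_all) (rule qser_summable)
  then have "((\<lambda>w. \<Sum>k. d k * w ^ k) has_field_derivative (\<Sum>k. diffs d k * 0 ^ k)) (at 0)"
    by (rule termdiffs_strong_converges_everywhere)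
  then have "deriv (deriv qser) 0 = (\<Sum>k. diffs d k * 0 ^ k)"
    unfolding deriv_qser[abs_def] d_def[symmetric] by (rule DERIV_imp_deriv)
  also have "\<dots> = diffs d 0" by (subst powser_zero) simp
  finally show ?thesis by (simp add: d_def diffs_def numeral_2_eq_2)
qed

lemma deriv_qser_0: "deriv qser 0 = of_real (qcoef \<kappa> \<theta> q b 1)"
  unfolding deriv_qser by (simp add: powser_zero diffs_def)

text \<open>The quotient of the two sides is 2 \<theta> (1 - b) / ((1 + q) (1 - b q)). It is below 1
  because \<theta> is at most q and (1 + q) (1 - b q) - 2 q (1 - b) = (1 - q) (1 + b q) > 0.\<close>

lemma second_qser: "deriv (deriv qser) 0 \<noteq> (deriv qser 0)\<^sup>2"
proof -
  have "2 * \<theta> * (1 - b) \<le> 2 * q * (1 - b)" using \<theta>_bounds b by simp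
  also have "2 * q * (1 - b) = (1 + q) * (1 - b * q) - ((1 - q) + b * q * (1 - q))" by (simp add: algebra_simps)
  also have "(1 - q) + b * q * (1 - q) > 0" using q b by (intro add_pos_nonneg mult_nonneg_nonneg) auto
  then have "(1 + q) * (1 - b * q) - ((1 - q) + b * q * (1 - q)) < (1 + q) * (1 - b * q)" by simp
  finally have *: "2 * \<theta> * (1 - b) < (1 + q) * (1 - b * q)" .
  have d: "1 - q > 0" "1 - b > 0" "1 - b * q > 0" "1 + q > 0" using q b q_factors_pos(2)[OF q b, of 1] by auto
  have c1: "qcoef \<kappa> \<theta> q b 1 = - \<kappa> / ((1 - q) * (1 - b))" by (simp add: qcoef_def)
  have c2: "qcoef \<kappa> \<theta> q b 2 = \<kappa>\<^sup>2 * \<theta> / ((1 - q) * (1 - b) * ((1 - q) * (1 + q) * (1 - b * q)))"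
    by (simp add: qcoef_def numeral_2_eq_2 lessThan_Suc algebra_simps power2_eq_square)
  have "2 * qcoef \<kappa> \<theta> q b 2 = \<kappa>\<^sup>2 / ((1 - q)\<^sup>2 * (1 - b)\<^sup>2) * (2 * \<theta> * (1 - b) / ((1 + q) * (1 - b * q)))"
    unfolding c2 using d by (simp add: divide_simps power2_eq_square)
  also have "\<dots> < \<kappa>\<^sup>2 / ((1 - q)\<^sup>2 * (1 - b)\<^sup>2) * 1"
    using * d \<kappa> by (intro mult_strict_left_mono) auto
  also have "\<dots> = (qcoef \<kappa> \<theta> q b 1)\<^sup>2" unfolding c1 by (simp add: power_divide power_mult_distrib)
  finally show ?thesis unfolding deriv_deriv_qser_0 deriv_qser_0 of_real_power[symmetric] of_real_eq_iff by simp
qed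

lemma poly_qpol_suminf: "poly (qpol \<kappa> \<theta> q b 1 n) z = (\<Sum>k. of_real (qcoef \<kappa> \<theta> q b k * qfall q n k) * z ^ k)"
  unfolding poly_qpol by (subst suminf_finite[of "{..n}"]) (auto simp: qfall_eq_0 q)

text \<open>On the disc the error is dominated, independently of z, by the sum over k of
  \<open>f k n\<close>. Its terms tend to 0 in n under a summable majorant, so the sum tends to 0 by
  Tannery's theorem.\<close>

lemma qpol_uniform_limit: "uniform_limit (ball 0 R) (\<lambda>n. poly (qpol \<kappa> \<theta> q b 1 n)) qser sequentially"
proof -
  define f where "f = (\<lambda>k n. \<bar>qcoef \<kappa> \<theta> q b k\<bar> * \<bar>R\<bar> ^ k * (1 - qfall q n k))"
  have fb: "0 \<le> f k n" "f k n \<le> \<bar>qcoef \<kappa> \<theta> q b k\<bar> * \<bar>R\<bar> ^ k" for k n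
    using qfall_bounds[OF q, of n k] by (auto simp: f_def intro!: mult_nonneg_nonneg mult_left_le)
  have "(\<lambda>n. \<Sum>k. f k n) \<longlonglongrightarrow> (\<Sum>k. 0)"
  proof (rule tannerys_theorem[THEN conjunct2, THEN conjunct2])
    show "(\<lambda>n. f k n) \<longlonglongrightarrow> 0" for k
    proof -
      have "(\<lambda>n. f k n) \<longlonglongrightarrow> \<bar>qcoef \<kappa> \<theta> q b k\<bar> * \<bar>R\<bar> ^ k * (1 - 1)"
        unfolding f_def by (intro tendsto_intros qfall_tendsto q)
      then show ?thesis by simp
    qed
    show "\<forall>\<^sub>F (k, n) in sequentially \<times>\<^sub>F sequentially. norm (f k n) \<le> \<bar>qcoef \<kappa> \<theta> q b k\<bar> * \<bar>R\<bar> ^ k"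
      using fb by (intro always_eventually) auto
  qed (use qcoef_summable in auto)
  then have lim0: "(\<lambda>n. \<Sum>k. f k n) \<longlonglongrightarrow> 0" by simp
  have fs: "summable (\<lambda>k. f k n)" for n
    by (rule summable_comparison_test'[OF qcoef_summable[of "\<bar>R\<bar>"], of 0]) (use fb in auto)
  have dist: "dist (poly (qpol \<kappa> \<theta> q b 1 n) z) (qser z) \<le> (\<Sum>k. f k n)" if z: "z \<in> ball 0 R" for z n
  proof -
    let ?g = "\<lambda>k. of_real (qcoef \<kappa> \<theta> q b k) * z ^ k" and ?h = "\<lambda>k. of_real (qcoef \<kappa> \<theta> q b k * qfall q n k) * z ^ k"
    have hs: "summable ?h" by (rule summable_finite[of "{..n}"]) (auto simp: qfall_eq_0 q)
    have nb: "cmod (?g k - ?h k) \<le> f k n" for k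
    proof -
      have "?g k - ?h k = of_real (qcoef \<kappa> \<theta> q b k * (1 - qfall q n k)) * z ^ k" by (simp add: algebra_simps)
      then have "cmod (?g k - ?h k) = \<bar>qcoef \<kappa> \<theta> q b k\<bar> * (1 - qfall q n k) * cmod z ^ k"
        using qfall_bounds[OF q, of n k] by (simp only: norm_mult norm_of_real norm_power abs_mult) simp
      also have "\<dots> \<le> \<bar>qcoef \<kappa> \<theta> q b k\<bar> * (1 - qfall q n k) * \<bar>R\<bar> ^ k"
        using qfall_bounds[OF q, of n k] z by (intro mult_left_mono power_mono mult_nonneg_nonneg) auto
      finally show ?thesis by (simp add: f_def mult_ac)
    qed
    have "qser z - poly (qpol \<kappa> \<theta> q b 1 n) z = (\<Sum>k. ?g k - ?h k)"
      unfolding qser_def poly_qpol_suminf by (rule suminf_diff[OF qser_summable hs])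
    then have "dist (poly (qpol \<kappa> \<theta> q b 1 n) z) (qser z) = cmod (\<Sum>k. ?g k - ?h k)"
      by (simp add: dist_norm norm_minus_commute)
    also have "\<dots> \<le> (\<Sum>k. f k n)" by (rule norm_suminf_le) (use nb fs in auto)
    finally show ?thesis .
  qed
  show ?thesis
  proof (rule uniform_limitI)
    fix e :: real assume "e > 0"
    then have "\<forall>\<^sub>F n in sequentially. (\<Sum>k. f k n) < e" using lim0 by (rule order_tendstoD(2)[rotated])
    then show "\<forall>\<^sub>F n in sequentially. \<forall>z\<in>ball 0 R. dist (poly (qpol \<kappa> \<theta> q b 1 n) z) (qser z) < e"
      by eventually_elim (use dist in \<open>blast intro: le_less_trans\<close>)
  qed
qed

lemma qser_positive_root_limit: "\<exists>a m. positive_root_limit qser a m"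
proof -
  have "\<exists>(m::nat) a. (\<forall>i. (0::real) < a i) \<and> (\<forall>z. poly (qpol \<kappa> \<theta> q b 1 n) z = (\<Prod>i<m. 1 - a i * z))" for n
  proof (rule poly_real_roots_prod)
    have "poly (qpol \<kappa> \<theta> q b 1 n) 0 = coeff (qpol \<kappa> \<theta> q b 1 n) 0" by (rule poly_0_coeff_0)
    then show "poly (qpol \<kappa> \<theta> q b 1 n) 0 = 1" using q by (simp add: coeff_qpol)
  qed (rule qpol_root_real[OF q b \<kappa> \<theta>])
  then obtain m :: "nat \<Rightarrow> nat" and a where a: "\<And>n i. (0::real) < a n i"
    "\<And>n z. poly (qpol \<kappa> \<theta> q b 1 n) z = (\<Prod>i<m n. 1 - a n i * z)" by metis
  have "positive_root_limit qser a m"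
  proof
    show "uniform_limit (ball 0 R) (\<lambda>n z. \<Prod>i<m n. 1 - of_real (a n i) * z) qser sequentially" for R
      using qpol_uniform_limit[of R] unfolding a(2)[abs_def] .
  qed (use a second_qser in auto)
  then show ?thesis by blast
qed

end

section \<open>Radii of starlikeness\<close>

text \<open>A point of modulus x at which the inequality fails belongs to every larger disc, so
  nothing has to be known about f outside the closed disc of radius x.\<close>

lemma starlike_radius_eqI:
  assumes x: "x > 0" and hol: "f holomorphic_on ball 0 x"
    and Re: "\<And>z. z \<noteq> 0 \<Longrightarrow> cmod z < x \<Longrightarrow> Re (z * deriv f z / f z) > \<alpha>"
    and w: "cmod w = x" "Re (w * deriv f w / f w) \<le> \<alpha>"
  shows "starlike_radius \<alpha> f = ereal x"
  unfolding starlike_radius_def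
proof (rule antisym)
  let ?S = "{r. r > 0 \<and> f holomorphic_on ball 0 r \<and> (\<forall>z \<in> ball 0 r - {0}. Re (z * deriv f z / f z) > \<alpha>)}"
  have "r \<le> x" if "r \<in> ?S" for r
  proof (rule ccontr)
    assume "\<not> r \<le> x"
    then have "w \<in> ball 0 r - {0}" using w(1) x by auto
    then have "Re (w * deriv f w / f w) > \<alpha>" using that by blast
    then show False using w(2) by simp
  qed
  then show "Sup (ereal ` ?S) \<le> ereal x" by (intro Sup_least) auto
  have "x \<in> ?S" using x hol Re by auto
  then show "ereal x \<le> Sup (ereal ` ?S)" by (intro Sup_upper) auto
qed

context positive_root_limit begin

text \<open>The worst point of each circle is the positive one. The exponent k is 2 for
  \<open>f_norm\<close> and \<open>g_norm\<close> and 1 for \<open>h_norm\<close>, with c = 2 /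
  \<nu>, 2 and 1 respectively.\<close>

lemma starlike_radius_pos:
  assumes c: "c > 0" and \<alpha>: "\<alpha> < 1" and \<rho>: "\<rho> > 0" "\<rho> ^ k = w1" and k: "k > 0"
    and hol: "f holomorphic_on ball 0 \<rho>"
    and ld: "\<And>z. z \<noteq> 0 \<Longrightarrow> cmod z < \<rho> \<Longrightarrow> z * deriv f z / f z = 1 - of_real c * (z ^ k * LP (z ^ k))"
  shows "\<exists>x. 0 < x \<and> x < \<rho> \<and> c * (x ^ k * Lr (x ^ k)) = 1 - \<alpha> \<and>
    (\<forall>t. 0 < t \<and> t < x \<longrightarrow> c * (t ^ k * Lr (t ^ k)) < 1 - \<alpha>) \<and> starlike_radius \<alpha> f = ereal x"
proof -
  from \<alpha> have "1 - \<alpha> > 0" by simp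
  then obtain y where y: "0 < y" "y < w1" "c * (y * Lr y) = 1 - \<alpha>" "\<And>t. 0 \<le> t \<Longrightarrow> t < y \<Longrightarrow> c * (t * Lr t) < 1 - \<alpha>"
    using smallest_root[OF c] by blast
  define x where "x = root k y"
  have xk: "x ^ k = y" and x0: "x > 0" using y(1) k by (auto simp: x_def)
  have x\<rho>: "x < \<rho>" by (rule power_less_imp_less_base[of _ k]) (use xk y(2) \<rho> in auto)
  have less: "c * (t ^ k * Lr (t ^ k)) < 1 - \<alpha>" if "0 \<le> t" "t < x" for t
    using y(4)[of "t ^ k"] power_strict_mono[OF that(2,1) k] that xk by simp
  have "starlike_radius \<alpha> f = ereal x"
  proof (rule starlike_radius_eqI[OF x0, where w = "of_real x"])
    show "f holomorphic_on ball 0 x" using hol by (rule holomorphic_on_subset) (use x\<rho> in auto)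
    show "Re (z * deriv f z / f z) > \<alpha>" if z: "z \<noteq> 0" "cmod z < x" for z
    proof -
      have "cmod (z ^ k) < w1" using power_strict_mono[OF z(2) norm_ge_zero k] xk y(2) by (simp add: norm_power)
      from Re_LP_upper[OF this] have "c * Re (z ^ k * LP (z ^ k)) \<le> c * (cmod z ^ k * Lr (cmod z ^ k))"
        using c by (simp add: norm_power)
      also have "\<dots> < 1 - \<alpha>" using less[of "cmod z"] z by simp
      also have "c * Re (z ^ k * LP (z ^ k)) = Re (of_real c * (z ^ k * LP (z ^ k)))" by simp
      finally have "Re (1 - of_real c * (z ^ k * LP (z ^ k))) > \<alpha>" by (simp only: minus_complex.sel one_complex.sel)
      then show ?thesis using ld[OF z(1)] z(2) x\<rho> by simp
    qed
    have "of_real x * deriv f (of_real x) / f (of_real x) = 1 - of_real c * (of_real x ^ k * LP (of_real x ^ k))"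
      by (rule ld) (use x0 x\<rho> in auto)
    also have "\<dots> = of_real (1 - c * (y * Lr y))"
      unfolding of_real_power[symmetric] xk LP_of_real[OF y(2)] by simp
    finally show "Re (of_real x * deriv f (of_real x) / f (of_real x)) \<le> \<alpha>"
      using y(3) by (simp only: Re_complex_of_real)
  qed (use x0 in auto)
  then show ?thesis using x0 x\<rho> less xk y(3) by auto
qed

text \<open>With the sign of c reversed, the lower bound for Re (w LP(w)) is decisive. It is
  attained at negative w = \<open>z\<^sup>2\<close>, that is, on the imaginary axis. From \<alpha>
  \<ge> 0 and c > 2 follows c > 2 (1 - \<alpha>), as \<open>unique_neg_root\<close> demands.\<close>

lemma starlike_radius_neg:
  assumes c: "c > 2" and \<alpha>: "0 \<le> \<alpha>" "\<alpha> < 1" and \<rho>: "\<rho> > 0" "\<rho>\<^sup>2 = w1"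
    and hol: "f holomorphic_on ball 0 \<rho>"
    and ld: "\<And>z. z \<noteq> 0 \<Longrightarrow> cmod z < \<rho> \<Longrightarrow> z * deriv f z / f z = 1 + of_real c * (z\<^sup>2 * LP (z\<^sup>2))"
  shows "\<exists>x. 0 < x \<and> c * (x\<^sup>2 * Lr (- x\<^sup>2)) = 1 - \<alpha> \<and>
    (\<forall>t. 0 < t \<and> c * (t\<^sup>2 * Lr (- t\<^sup>2)) = 1 - \<alpha> \<longrightarrow> t = x) \<and> starlike_radius \<alpha> f = ereal x"
proof -
  from \<alpha> have "1 - \<alpha> > 0" "c > 2 * (1 - \<alpha>)" using c by auto
  then obtain y where y: "0 < y" "y < w1" "c * (y * Lr (- y)) = 1 - \<alpha>" "\<And>t. 0 \<le> t \<Longrightarrow> t < y \<Longrightarrow> c * (t * Lr (- t)) < 1 - \<alpha>"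
     "\<And>t. y < t \<Longrightarrow> c * (t * Lr (- t)) > 1 - \<alpha>"
    using unique_neg_root[of "1 - \<alpha>" c] by blast
  define x where "x = sqrt y"
  have xk: "x\<^sup>2 = y" and x0: "x > 0" using y(1) by (auto simp: x_def)
  have x\<rho>: "x < \<rho>" by (rule power_less_imp_less_base[of _ 2]) (use xk y(2) \<rho> in auto)
  have uniq: "t = x" if "0 < t" "c * (t\<^sup>2 * Lr (- t\<^sup>2)) = 1 - \<alpha>" for t
  proof -
    have "t\<^sup>2 = y" using y(4)[of "t\<^sup>2"] y(5)[of "t\<^sup>2"] that(2) by (cases "t\<^sup>2" y rule: linorder_cases) auto
    then show ?thesis using that(1) by (auto simp: x_def)
  qed
  have cp: "c > 0" using c by simp
  have "starlike_radius \<alpha> f = ereal x"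
  proof (rule starlike_radius_eqI[OF x0, where w = "\<i> * of_real x"])
    show "f holomorphic_on ball 0 x" using hol by (rule holomorphic_on_subset) (use x\<rho> in auto)
    show "Re (z * deriv f z / f z) > \<alpha>" if z: "z \<noteq> 0" "cmod z < x" for z
    proof -
      have zy: "(cmod z)\<^sup>2 < y" using power_strict_mono[OF z(2) norm_ge_zero, of 2] xk by simp
      then have "cmod (z\<^sup>2) < w1" using y(2) by (simp add: norm_power)
      from Re_LP_lower[OF this] have "c * Re (z\<^sup>2 * LP (z\<^sup>2)) \<ge> c * - ((cmod z)\<^sup>2 * Lr (- (cmod z)\<^sup>2))"
        using cp unfolding norm_power by (intro mult_left_mono) auto
      moreover have "c * ((cmod z)\<^sup>2 * Lr (- (cmod z)\<^sup>2)) < 1 - \<alpha>" using y(4)[OF _ zy] by simp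
      moreover have "c * Re (z\<^sup>2 * LP (z\<^sup>2)) = Re (of_real c * (z\<^sup>2 * LP (z\<^sup>2)))" by simp
      ultimately have "Re (1 + of_real c * (z\<^sup>2 * LP (z\<^sup>2))) > \<alpha>" by (simp only: plus_complex.sel one_complex.sel)
      then show ?thesis using ld[OF z(1)] z(2) x\<rho> by simp
    qed
    have sq: "(\<i> * complex_of_real x)\<^sup>2 = of_real (- y)" using xk by (simp add: power_mult_distrib flip: of_real_power)
    have "\<i> * of_real x * deriv f (\<i> * of_real x) / f (\<i> * of_real x) = 1 + of_real c * ((\<i> * of_real x)\<^sup>2 * LP ((\<i> * of_real x)\<^sup>2))"
      by (rule ld) (use x0 x\<rho> in \<open>auto simp: norm_mult\<close>)
    also have "\<dots> = of_real (1 - c * (y * Lr (- y)))"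
      unfolding sq using y(1) w1(1) by (subst LP_of_real) auto
    finally show "Re (\<i> * of_real x * deriv f (\<i> * of_real x) / f (\<i> * of_real x)) \<le> \<alpha>"
      using y(3) by (simp only: Re_complex_of_real)
  qed (use x0 in \<open>auto simp: norm_mult\<close>)
  moreover have "c * (x\<^sup>2 * Lr (- x\<^sup>2)) = 1 - \<alpha>" unfolding xk by (rule y(3))
  ultimately show ?thesis using x0 uniq by blast
qed

section \<open>Logarithmic derivatives of the normalized functions\<close>

lemma deriv_P_eq: "P w \<noteq> 0 \<Longrightarrow> deriv P w = - LP w * P w"
  by (simp add: LP_def)

lemma DERIV_P: "(P has_field_derivative deriv P z) (at z)"
  by (rule holomorphic_derivI[OF P_holomorphic open_UNIV]) simp

lemma logderiv_times_P_power:
  assumes z: "z \<noteq> 0" and nz: "P (z ^ k) \<noteq> 0"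
  shows "z * deriv (\<lambda>z. z * P (z ^ k)) z / (z * P (z ^ k)) = 1 - of_nat k * (z ^ k * LP (z ^ k))"
proof -
  have "((\<lambda>z. z * P (z ^ k)) has_field_derivative 1 * P (z ^ k) + (deriv P (z ^ k) * (of_nat k * z ^ (k - 1))) * z) (at z)"
    by (rule DERIV_mult[OF DERIV_ident], rule DERIV_chain2[OF DERIV_P]) (auto intro!: derivative_eq_intros)
  then have "deriv (\<lambda>z. z * P (z ^ k)) z = P (z ^ k) + deriv P (z ^ k) * (of_nat k * z ^ (k - 1)) * z"
    by (simp add: DERIV_imp_deriv)
  also have "\<dots> = P (z ^ k) * (1 - of_nat k * (z ^ k * LP (z ^ k)))"
    unfolding deriv_P_eq[OF nz] by (cases k) (simp_all add: algebra_simps)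
  finally show ?thesis using z nz by simp
qed

text \<open>Differentiating exp l = \<phi> for the branch l gives l' = \<phi>' / \<phi>, so the
  choice of branch disappears from z f'(z) / f(z) = 1 + z l'(z) / \<nu>.\<close>

lemma logderiv_log_branch:
  assumes \<rho>: "\<rho>\<^sup>2 = w1" "\<rho> > 0" and \<nu>: "\<nu> \<noteq> 0"
  defines "\<phi> \<equiv> \<lambda>z. P (z\<^sup>2)"
  defines "f \<equiv> \<lambda>z. z * exp (log_branch \<phi> z / complex_of_real \<nu>)"
  shows "f holomorphic_on ball 0 \<rho>"
    and "z \<noteq> 0 \<Longrightarrow> cmod z < \<rho> \<Longrightarrow> z * deriv f z / f z = 1 - of_real (2 / \<nu>) * (z\<^sup>2 * LP (z\<^sup>2))"
proof -
  have hol: "\<phi> holomorphic_on ball 0 \<rho>" unfolding \<phi>_def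
    using holomorphic_on_compose[OF holomorphic_on_power[OF holomorphic_on_ident] P_holomorphic, of 2] by (simp add: o_def)
  have nz: "\<phi> z \<noteq> 0" if "z \<in> ball 0 \<rho>" for z
    unfolding \<phi>_def by (rule P_nonzero) (use that power_strict_mono[of "cmod z" \<rho> 2] \<rho> in \<open>simp add: norm_power\<close>)
  have one: "\<phi> 0 = 1" by (simp add: \<phi>_def)
  have lbh: "log_branch \<phi> holomorphic_on ball 0 \<rho>" by (rule log_branch_holomorphic[OF hol _ one]) (rule nz)
  have elb: "exp (log_branch \<phi> z) = \<phi> z" if "z \<in> ball 0 \<rho>" for z by (rule exp_log_branch[OF hol _ one that]) (rule nz)
  show "f holomorphic_on ball 0 \<rho>" unfolding f_def using \<nu> by (intro holomorphic_intros lbh) auto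
  show "z * deriv f z / f z = 1 - of_real (2 / \<nu>) * (z\<^sup>2 * LP (z\<^sup>2))" if z: "z \<noteq> 0" "cmod z < \<rho>"
  proof -
    have zb: "z \<in> ball 0 \<rho>" using z by simp
    define l where "l = log_branch \<phi>"
    have dl: "(l has_field_derivative deriv l z) (at z)"
      unfolding l_def by (rule holomorphic_derivI[OF lbh _ zb]) auto
    have "(\<phi> has_field_derivative exp (l z) * deriv l z) (at z)"
      by (rule has_field_derivative_transform_within_open[OF DERIV_chain2[OF DERIV_exp dl], of "ball 0 \<rho>"])
        (use zb elb in \<open>auto simp: l_def\<close>)
    moreover have "(\<phi> has_field_derivative deriv P (z\<^sup>2) * (2 * z)) (at z)"
      unfolding \<phi>_def by (rule DERIV_chain2[OF DERIV_P]) (auto intro!: derivative_eq_intros)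
    ultimately have "exp (l z) * deriv l z = deriv P (z\<^sup>2) * (2 * z)" by (rule DERIV_unique)
    moreover have "exp (l z) = P (z\<^sup>2)" using elb[OF zb] by (simp add: l_def \<phi>_def)
    moreover have "P (z\<^sup>2) \<noteq> 0" using nz[OF zb] by (simp add: \<phi>_def)
    ultimately have dlz: "deriv l z = - (2 * z * LP (z\<^sup>2))" by (simp add: LP_def field_simps)
    have "(f has_field_derivative 1 * exp (l z / of_real \<nu>) + (exp (l z / of_real \<nu>) * (deriv l z / of_real \<nu>)) * z) (at z)"
      unfolding f_def l_def[symmetric]
      by (rule DERIV_mult[OF DERIV_ident], rule DERIV_chain2[OF DERIV_exp], rule DERIV_cdivide[OF dl])
    then have "deriv f z = 1 * exp (l z / of_real \<nu>) + (exp (l z / of_real \<nu>) * (deriv l z / of_real \<nu>)) * z"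
      by (rule DERIV_imp_deriv)
    also have "\<dots> = exp (l z / of_real \<nu>) * (1 - of_real (2 / \<nu>) * (z\<^sup>2 * LP (z\<^sup>2)))"
      unfolding dlz by (simp add: algebra_simps power2_eq_square)
    finally show ?thesis using z by (simp add: f_def l_def)
  qed
qed

end

section \<open>The q-Bessel functions\<close>

lemma qpoch_Suc: "qpoch a q (Suc n) = qpoch a q n * (1 - a * q ^ n)"
  by (simp add: qpoch_def)

lemma qpoch_inf_nonzero:
  assumes "0 < q" "q < 1" "0 < a" "a < 1"
  shows "qpoch_inf a q \<noteq> 0"
proof -
  have "summable (\<lambda>k. a * q ^ k)" using assms by (intro summable_mult summable_geometric) simp
  then have "summable (\<lambda>k. norm ((1 - a * q ^ k) - 1))" using assms by simp
  then have "convergent_prod (\<lambda>k. 1 - a * q ^ k)"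
    by (intro abs_convergent_prod_imp_convergent_prod) (simp add: abs_convergent_prod_conv_summable)
  moreover have "1 - a * q ^ k \<noteq> 0" for k using q_factors_pos(2)[OF assms, of k] by simp
  ultimately show ?thesis unfolding qpoch_inf_def by (rule prodinf_nonzero)
qed

lemma cpow_eq_powr: "z \<noteq> 0 \<Longrightarrow> cpow z a = z powr of_real a"
  by (simp add: cpow_def)

lemma cpow_add_nat: assumes "z \<noteq> 0" shows "cpow z (2 * real n + a) = cpow z a * (z\<^sup>2) ^ n"
proof -
  have "z powr of_real (2 * real n + a) = z powr (of_real a) * z powr (of_nat (2 * n))"
    by (simp add: powr_add add.commute)
  then show ?thesis using assms by (simp add: cpow_eq_powr powr_nat' power_mult del: of_nat_mult)
qed

lemma cpow_half: assumes "z \<noteq> 0" shows "cpow (z / 2) a = cpow z a / of_real (2 powr a)"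
proof -
  have "Ln (z / 2) = Ln z - of_real (ln 2)" using Ln_divide_of_real[of 2 z] assms by simp
  moreover have "(z / 2) powr of_real a = exp (of_real a * Ln (z / 2))"
    using assms by (simp add: powr_def)
  ultimately have "(z / 2) powr of_real a = exp (of_real a * Ln z - of_real (a * ln 2))"
    by (simp only: right_diff_distrib of_real_mult)
  also have "\<dots> = z powr of_real a / of_real (2 powr a)"
    using assms by (simp add: exp_diff powr_def exp_of_real[symmetric])
  finally show ?thesis using assms by (simp add: cpow_eq_powr)
qed

text \<open>From n to n + 1 the exponent n (n + \<nu>) grows by (\<nu> + 1) + 2 n, which yields the
  factor b and the base \<theta> = \<open>q\<^sup>2\<close>. The 4 comes from z / 2 in the
  series.\<close>

lemma jackson_qcoef:
  fixes q \<nu> :: real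
  assumes "0 < q"
  defines "b \<equiv> q powr (\<nu> + 1)"
  shows "qcoef (b / 4) (q\<^sup>2) q b n = (-1) ^ n * q powr (real n * (real n + \<nu>)) / (qpoch q q n * qpoch b q n) / 4 ^ n"
proof (induction n)
  case (Suc n)
  have "q powr (real (Suc n) * (real (Suc n) + \<nu>)) = q powr (real n * (real n + \<nu>) + (\<nu> + 1) + real (2 * n))"
    by (rule arg_cong[of _ _ "\<lambda>x. q powr x"]) (simp add: algebra_simps)
  also have "\<dots> = q powr (real n * (real n + \<nu>)) * b * (q\<^sup>2) ^ n"
    unfolding powr_add powr_realpow[OF assms(1)] b_def by (simp add: power_mult)
  finally show ?case
    unfolding qcoef_Suc Suc qpoch_Suc by (simp add: mult_ac)
qed (use assms in \<open>simp add: qpoch_def\<close>)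

text \<open>The exponent n (n + 1) / 2 grows by n + 1, whence \<kappa> = \<theta> = q.\<close>

lemma hahn_exton_qcoef:
  assumes "0 < q"
  shows "qcoef q q q b n = (-1) ^ n * q powr (real n * (real n + 1) / 2) / (qpoch q q n * qpoch b q n)"
proof (induction n)
  case (Suc n)
  have "q powr (real (Suc n) * (real (Suc n) + 1) / 2) = q powr (real n * (real n + 1) / 2 + real (Suc n))"
    by (rule arg_cong[of _ _ "\<lambda>x. q powr x"]) (simp add: field_simps)
  also have "\<dots> = q powr (real n * (real n + 1) / 2) * q ^ Suc n"
    unfolding powr_add powr_realpow[OF assms(1)] ..
  finally show ?case
    unfolding qcoef_Suc Suc qpoch_Suc by (simp add: mult_ac)
qed (use assms in \<open>simp add: qpoch_def\<close>)

text \<open>A common interface: afterwards both q-Bessel functions are used mainly through this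
  factorization. The point 0 is left out because the value of \<open>cpow\<close> there depends on
  \<nu>.\<close>

lemma qbessel_factorization:
  assumes q: "0 < q" "q < 1" and \<nu>: "\<nu> > -1" and s: "s \<in> {2, 3}"
  shows "\<exists>P a m. positive_root_limit P a m \<and> norm_const s \<nu> q \<noteq> 0 \<and>
    (\<forall>z. z \<noteq> 0 \<longrightarrow> qbessel s \<nu> q z = cpow z \<nu> * P (z\<^sup>2) / of_real (norm_const s \<nu> q))"
proof -
  define b where "b = q powr (\<nu> + 1)"
  have b: "0 < b" "b < 1" using q \<nu> powr_less_mono'[of q 0 "\<nu> + 1"] by (auto simp: b_def)
  define N where "N = qpoch_inf b q / qpoch_inf q q"
  have N: "N \<noteq> 0" using qpoch_inf_nonzero[OF q b] qpoch_inf_nonzero[OF q q] by (simp add: N_def)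
  have c: "c_const \<nu> q = 1 / N" by (simp add: c_const_def N_def b_def)
  from s consider "s = 2" | "s = 3" by blast
  then show ?thesis
  proof cases
    case 1
    interpret qseries q b "b / 4" "q\<^sup>2" by unfold_locales (use q b in auto)
    have nc: "norm_const s \<nu> q = 2 powr \<nu> / N" using 1 by (simp add: norm_const_def c)
    have "qbessel s \<nu> q z = cpow z \<nu> * qser (z\<^sup>2) / of_real (norm_const s \<nu> q)" if z: "z \<noteq> 0" for z
    proof -
      have "qbessel s \<nu> q z = of_real N * (\<Sum>n. (-1) ^ n * cpow (z / 2) (2 * real n + \<nu>)
            / complex_of_real (qpoch q q n * qpoch b q n) * complex_of_real (q powr (real n * (real n + \<nu>))))"
        using 1 by (simp add: qbessel_def jackson_bessel_def N_def b_def)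
      also have "(\<lambda>n. (-1) ^ n * cpow (z / 2) (2 * real n + \<nu>)
            / complex_of_real (qpoch q q n * qpoch b q n) * complex_of_real (q powr (real n * (real n + \<nu>)))) =
          (\<lambda>n. (cpow z \<nu> / of_real (2 powr \<nu>)) * (of_real (qcoef (b / 4) (q\<^sup>2) q b n) * (z\<^sup>2) ^ n))"
      proof
        fix n
        have "cpow (z / 2) (2 * real n + \<nu>) = cpow z \<nu> / of_real (2 powr \<nu>) * ((z\<^sup>2) ^ n / 4 ^ n)"
          using cpow_add_nat[of "z / 2" n \<nu>] cpow_half[OF z, of \<nu>] z by (simp add: power_divide)
        moreover have "of_real (qcoef (b / 4) (q\<^sup>2) q b n) =
          (-1) ^ n * complex_of_real (q powr (real n * (real n + \<nu>))) / complex_of_real (qpoch q q n * qpoch b q n) / 4 ^ n"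
          unfolding jackson_qcoef[OF q(1), of \<nu> n, folded b_def] by simp
        ultimately show "(-1) ^ n * cpow (z / 2) (2 * real n + \<nu>)
            / complex_of_real (qpoch q q n * qpoch b q n) * complex_of_real (q powr (real n * (real n + \<nu>))) =
            (cpow z \<nu> / of_real (2 powr \<nu>)) * (of_real (qcoef (b / 4) (q\<^sup>2) q b n) * (z\<^sup>2) ^ n)"
          by (simp only:) (simp add: mult_ac)
      qed
      also have "(\<Sum>n. (cpow z \<nu> / of_real (2 powr \<nu>)) * (of_real (qcoef (b / 4) (q\<^sup>2) q b n) * (z\<^sup>2) ^ n)) =
          (cpow z \<nu> / of_real (2 powr \<nu>)) * qser (z\<^sup>2)"
        unfolding qser_def by (rule suminf_mult[OF qser_summable])
      finally show ?thesis by (simp add: nc mult_ac)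
    qed
    moreover have "norm_const s \<nu> q \<noteq> 0" using N by (simp add: nc)
    ultimately show ?thesis using qser_positive_root_limit by blast
  next
    case 2
    interpret qseries q b q q by unfold_locales (use q b in auto)
    have nc: "norm_const s \<nu> q = 1 / N" using 2 by (simp add: norm_const_def c)
    have "qbessel s \<nu> q z = cpow z \<nu> * qser (z\<^sup>2) / of_real (norm_const s \<nu> q)" if z: "z \<noteq> 0" for z
    proof -
      have "qbessel s \<nu> q z = of_real N * (\<Sum>n. (-1) ^ n * cpow z (2 * real n + \<nu>)
            / complex_of_real (qpoch q q n * qpoch b q n) * complex_of_real (q powr (real n * (real n + 1) / 2)))"
        using 2 by (simp add: qbessel_def hahn_exton_bessel_def N_def b_def)
      also have "(\<lambda>n. (-1) ^ n * cpow z (2 * real n + \<nu>)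
            / complex_of_real (qpoch q q n * qpoch b q n) * complex_of_real (q powr (real n * (real n + 1) / 2))) =
          (\<lambda>n. cpow z \<nu> * (of_real (qcoef q q q b n) * (z\<^sup>2) ^ n))"
      proof
        fix n
        have "of_real (qcoef q q q b n) =
          (-1) ^ n * complex_of_real (q powr (real n * (real n + 1) / 2)) / complex_of_real (qpoch q q n * qpoch b q n)"
          unfolding hahn_exton_qcoef[OF q(1)] by simp
        then show "(-1) ^ n * cpow z (2 * real n + \<nu>)
            / complex_of_real (qpoch q q n * qpoch b q n) * complex_of_real (q powr (real n * (real n + 1) / 2)) =
            cpow z \<nu> * (of_real (qcoef q q q b n) * (z\<^sup>2) ^ n)"
          by (simp only: cpow_add_nat[OF z]) (simp add: mult_ac)
      qed
      also have "(\<Sum>n. cpow z \<nu> * (of_real (qcoef q q q b n) * (z\<^sup>2) ^ n)) = cpow z \<nu> * qser (z\<^sup>2)"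
        unfolding qser_def by (rule suminf_mult[OF qser_summable])
      finally show ?thesis by (simp add: nc mult_ac)
    qed
    moreover have "norm_const s \<nu> q \<noteq> 0" using N by (simp add: nc)
    ultimately show ?thesis using qser_positive_root_limit by blast
  qed
qed

section \<open>The Bessel equations in terms of the logarithmic derivative\<close>

context positive_root_limit begin

text \<open>This is z J'(z) = J(z) (\<nu> - 2 w LP(w)) with w = \<open>z\<^sup>2\<close>. Off the
  branch cut the principal power is differentiable; both r and \<open>\<i> * r\<close> with r > 0
  avoid the cut.\<close>

lemma deriv_cpow_times_P:
  assumes J: "\<And>z. z \<noteq> 0 \<Longrightarrow> J z = cpow z \<nu> * P (z\<^sup>2) / of_real c" and z: "z \<notin> \<real>\<^sub>\<le>\<^sub>0" and nz: "P (z\<^sup>2) \<noteq> 0"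
  shows "z * deriv J z - of_real \<mu> * J z = cpow z \<nu> * P (z\<^sup>2) / of_real c * (of_real (\<nu> - \<mu>) - 2 * (z\<^sup>2 * LP (z\<^sup>2)))"
proof -
  have z0: "z \<noteq> 0" using z by auto
  have e: "z * z powr (of_real \<nu> - 1) = z powr of_real \<nu>" using z0 by (simp add: powr_diff)
  have "((\<lambda>z. z powr of_real \<nu> * P (z\<^sup>2) / of_real c) has_field_derivative
      (of_real \<nu> * z powr (of_real \<nu> - 1) * P (z\<^sup>2) + deriv P (z\<^sup>2) * (2 * z) * z powr of_real \<nu>) / of_real c) (at z)"
    by (rule DERIV_cdivide, rule DERIV_mult[OF has_field_derivative_powr[OF z]], rule DERIV_chain2[OF DERIV_P])
      (auto intro!: derivative_eq_intros)
  then have "(J has_field_derivative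
      (of_real \<nu> * z powr (of_real \<nu> - 1) * P (z\<^sup>2) + deriv P (z\<^sup>2) * (2 * z) * z powr of_real \<nu>) / of_real c) (at z)"
    by (rule has_field_derivative_transform_within_open[of _ _ _ "- {0}"]) (use z0 J in \<open>auto simp: cpow_eq_powr\<close>)
  then have "deriv J z = (of_real \<nu> * z powr (of_real \<nu> - 1) * P (z\<^sup>2) + deriv P (z\<^sup>2) * (2 * z) * z powr of_real \<nu>) / of_real c"
    by (rule DERIV_imp_deriv)
  then have "z * deriv J z = (of_real \<nu> * (z * z powr (of_real \<nu> - 1)) * P (z\<^sup>2) + deriv P (z\<^sup>2) * (2 * z\<^sup>2) * z powr of_real \<nu>) / of_real c"
    by (simp add: algebra_simps power2_eq_square)
  then show ?thesis unfolding e J[OF z0] cpow_eq_powr[OF z0] deriv_P_eq[OF nz]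
    by (simp add: diff_divide_distrib add_divide_distrib algebra_simps)
qed

text \<open>Before the first zero the factor J(r) can be cancelled. For \<mu> = \<alpha> \<nu>,
  \<alpha> + \<nu> - 1 and 2 \<alpha> + \<nu> - 2 the right side becomes \<nu> (1 - \<alpha>), 1 -
  \<alpha> and 2 (1 - \<alpha>).\<close>

lemma root_iff_pos:
  assumes J: "\<And>z. z \<noteq> 0 \<Longrightarrow> J z = cpow z \<nu> * P (z\<^sup>2) / of_real c" and c: "c \<noteq> 0" and r: "r > 0" "r\<^sup>2 < w1"
  shows "of_real r * deriv J (of_real r) - of_real \<mu> * J (of_real r) = 0 \<longleftrightarrow> 2 * (r\<^sup>2 * Lr (r\<^sup>2)) = \<nu> - \<mu>"
proof -
  have r2: "(complex_of_real r)\<^sup>2 = of_real (r\<^sup>2)" by simp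
  have nz: "P ((complex_of_real r)\<^sup>2) \<noteq> 0" unfolding r2 by (rule P_real_nonzero[OF r(2)])
  have "of_real r * deriv J (of_real r) - of_real \<mu> * J (of_real r) =
      cpow r \<nu> * P ((of_real r)\<^sup>2) / of_real c * of_real (\<nu> - \<mu> - 2 * (r\<^sup>2 * Lr (r\<^sup>2)))"
    using deriv_cpow_times_P[OF J _ nz] r unfolding r2 LP_of_real[OF r(2)] by simp
  then show ?thesis using nz c r(1) by (auto simp: cpow_eq_powr simp del: of_real_diff of_real_mult of_real_power)
qed

text \<open>No upper bound on r appears, since \<open>P\<close> has no zero at
  \<open>- r\<^sup>2\<close>; so uniqueness can be claimed among all positive roots.\<close>

lemma root_iff_imaginary:
  assumes J: "\<And>z. z \<noteq> 0 \<Longrightarrow> J z = cpow z \<nu> * P (z\<^sup>2) / of_real c" and c: "c \<noteq> 0" and r: "r > 0"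
  shows "\<i> * of_real r * deriv J (\<i> * of_real r) - of_real \<mu> * J (\<i> * of_real r) = 0 \<longleftrightarrow> 2 * (r\<^sup>2 * Lr (- r\<^sup>2)) = \<mu> - \<nu>"
proof -
  have r2: "(\<i> * complex_of_real r)\<^sup>2 = of_real (- r\<^sup>2)" by (simp add: power_mult_distrib)
  have nz: "P ((\<i> * complex_of_real r)\<^sup>2) \<noteq> 0" unfolding r2 by (rule P_neg_nonzero) simp
  have lt: "- r\<^sup>2 < w1" using w1(1) by (rule le_less_trans[rotated]) simp
  have "\<i> * of_real r * deriv J (\<i> * of_real r) - of_real \<mu> * J (\<i> * of_real r) =
      cpow (\<i> * r) \<nu> * P ((\<i> * of_real r)\<^sup>2) / of_real c * of_real (\<nu> - \<mu> + 2 * (r\<^sup>2 * Lr (- r\<^sup>2)))"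
    using deriv_cpow_times_P[OF J _ nz] r unfolding r2 LP_of_real[OF lt]
    by (simp add: complex_nonpos_Reals_iff)
  then have "\<i> * of_real r * deriv J (\<i> * of_real r) - of_real \<mu> * J (\<i> * of_real r) = 0 \<longleftrightarrow> \<nu> - \<mu> + 2 * (r\<^sup>2 * Lr (- r\<^sup>2)) = 0"
    using nz c r(1) by (simp only: mult_eq_0_iff divide_eq_0_iff of_real_eq_0_iff) (simp add: cpow_eq_powr)
  then show ?thesis by linarith
qed

end

theorem theorem1:
  fixes q \<nu> \<alpha> :: real and s :: nat
  assumes "0 < q" and "q < 1" and "\<nu> > -1" and "s \<in> {2, 3}" and "0 \<le> \<alpha>" and "\<alpha> < 1"
  shows
    "(\<nu> > 0 \<longrightarrow>
       (\<exists>x. smallest_positive_root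
              (\<lambda>r. complex_of_real r * deriv (qbessel s \<nu> q) (complex_of_real r)
                   - complex_of_real (\<alpha> * \<nu>) * qbessel s \<nu> q (complex_of_real r)) x
          \<and> starlike_radius \<alpha> (f_norm s \<nu> q) = ereal x))
     \<and> (\<nu> < 0 \<longrightarrow>
       (\<exists>x. unique_positive_root
              (\<lambda>r. \<i> * complex_of_real r * deriv (qbessel s \<nu> q) (\<i> * complex_of_real r)
                   - complex_of_real (\<alpha> * \<nu>) * qbessel s \<nu> q (\<i> * complex_of_real r)) x
          \<and> starlike_radius \<alpha> (f_norm s \<nu> q) = ereal x))
     \<and> (\<exists>y. smallest_positive_root
              (\<lambda>r. complex_of_real r * deriv (qbessel s \<nu> q) (complex_of_real r)
                   - complex_of_real (\<alpha> + \<nu> - 1) * qbessel s \<nu> q (complex_of_real r)) y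
          \<and> starlike_radius \<alpha> (g_norm s \<nu> q) = ereal y)
     \<and> (\<exists>z. smallest_positive_root
              (\<lambda>r. complex_of_real (sqrt r) * deriv (qbessel s \<nu> q) (complex_of_real (sqrt r))
                   - complex_of_real (2 * \<alpha> + \<nu> - 2) * qbessel s \<nu> q (complex_of_real (sqrt r))) z
          \<and> starlike_radius \<alpha> (h_norm s \<nu> q) = ereal z)"
proof -
  define J where "J = qbessel s \<nu> q"
  define c where "c = norm_const s \<nu> q"
  obtain P a m where prl: "positive_root_limit P a m" and c0: "c \<noteq> 0"
    and J: "\<And>z. z \<noteq> 0 \<Longrightarrow> J z = cpow z \<nu> * P (z\<^sup>2) / of_real c"
    using qbessel_factorization[OF assms(1-4)] unfolding J_def c_def by blast
  interpret positive_root_limit P a m by (rule prl)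
  define \<rho> where "\<rho> = sqrt w1"
  have \<rho>: "\<rho> > 0" "\<rho>\<^sup>2 = w1" using w1(1) by (auto simp: \<rho>_def)
  have sq_less: "t\<^sup>2 < w1" if "0 < t" "t < \<rho>" for t
    using power_strict_mono[of t \<rho> 2] that \<rho> by simp
  have gb: "g_norm s \<nu> q = (\<lambda>z. z * P (z ^ 2))"
  proof
    fix z
    show "g_norm s \<nu> q z = z * P (z ^ 2)"
    proof (cases "z = 0")
      case True
      \<comment> \<open>The default values at 0 matter: the power vanishes unless \<nu> = 1, when it
        is 1; but then all exponents 2 n + 1 in the series are nonzero and J(0) = 0.\<close>
      have "cpow 0 (1 - \<nu>) * J 0 = 0"
      proof (cases "\<nu> = 1")
        case True
        have "2 * real n + 1 \<noteq> 0" for n by linarith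
        then show ?thesis using True
          by (simp add: cpow_def J_def qbessel_def jackson_bessel_def hahn_exton_bessel_def)
      qed (simp add: cpow_def)
      then show ?thesis using True by (simp add: g_norm_def J_def)
    next
      case False
      have "cpow z (1 - \<nu>) * cpow z \<nu> = z"
        using False by (simp add: cpow_eq_powr powr_diff)
      then show ?thesis using False c0 J[OF False] by (simp add: g_norm_def flip: J_def c_def)
    qed
  qed
  have hb: "h_norm s \<nu> q = (\<lambda>z. z * P (z ^ 1))"
  proof
    fix z
    show "h_norm s \<nu> q z = z * P (z ^ 1)"
    proof (cases "z = 0")
      case True
      have "cpow 0 (1 - \<nu> / 2) * J 0 = 0"
      proof (cases "\<nu> = 2")
        case True
        have "2 * real n + 2 \<noteq> 0" for n by linarith
        then show ?thesis using True
          by (simp add: cpow_def J_def qbessel_def jackson_bessel_def hahn_exton_bessel_def)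
      qed (simp add: cpow_def)
      then show ?thesis using True by (simp add: h_norm_def J_def)
    next
      case False
      \<comment> \<open>Halving keeps the imaginary part of the logarithm within the principal
        strip, so the powers combine to z on the negative axis as well.\<close>
      have "csqrt z = exp (Ln z / 2)" using False by (rule csqrt_exp_Ln)
      moreover have "Ln (exp (Ln z / 2)) = Ln z / 2"
        using mpi_less_Im_Ln[OF False] Im_Ln_le_pi[OF False] pi_gt_zero by (intro Ln_exp) auto
      ultimately have "Ln (csqrt z) = Ln z / 2" by simp
      moreover have "cpow (csqrt z) \<nu> = exp (\<nu> * Ln (csqrt z))"
        using False by (simp add: cpow_eq_powr powr_def)
      ultimately have "cpow (csqrt z) \<nu> = exp (\<nu> * (Ln z / 2))" by (simp only:)
      then have "cpow z (1 - \<nu> / 2) * cpow (csqrt z) \<nu> = exp ((1 - \<nu> / 2) * Ln z + \<nu> * (Ln z / 2))"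
        using False by (simp add: cpow_eq_powr powr_def exp_add)
      also have "\<dots> = z" using False by (simp add: algebra_simps)
      finally show ?thesis using False c0 J[of "csqrt z"] by (simp add: h_norm_def flip: J_def c_def)
    qed
  qed
  have fb: "f_norm s \<nu> q = (\<lambda>z. z * exp (log_branch (\<lambda>z. P (z\<^sup>2)) z / of_real \<nu>))"
  proof -
    \<comment> \<open>Equality as functions, including the point 0, is needed:
      \<open>log_branch\<close> involves the derivative of its argument along a segment starting at
      0.\<close>
    have "f_base s \<nu> q = (\<lambda>z. P (z\<^sup>2))"
    proof
      fix z show "f_base s \<nu> q z = P (z\<^sup>2)"
        using c0 J[of z] by (cases "z = 0") (simp_all add: f_base_def cpow_eq_powr powr_minus flip: J_def c_def)
    qed
    then show ?thesis unfolding f_norm_def[abs_def] by simp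
  qed
  have hol: "(\<lambda>z. z * P (z ^ k)) holomorphic_on S" for k S
    using holomorphic_on_compose[OF holomorphic_on_power[OF holomorphic_on_ident] P_holomorphic, of k]
    by (intro holomorphic_intros) (simp add: o_def)
  show ?thesis unfolding J_def[symmetric]
  proof (intro conjI impI)
    assume \<nu>: "\<nu> > 0"
    have c: "2 / \<nu> > 0" and \<nu>0: "\<nu> \<noteq> 0" using \<nu> by auto
    note lb = logderiv_log_branch[OF \<rho>(2,1) \<nu>0]
    have holf: "f_norm s \<nu> q holomorphic_on ball 0 \<rho>" unfolding fb by (rule lb(1))
    have ld: "z * deriv (f_norm s \<nu> q) z / f_norm s \<nu> q z = 1 - of_real (2 / \<nu>) * (z\<^sup>2 * LP (z\<^sup>2))"
      if "z \<noteq> 0" "cmod z < \<rho>" for z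
      unfolding fb by (rule lb(2)[OF that])
    obtain x where x: "0 < x" "x < \<rho>" "2 / \<nu> * (x\<^sup>2 * Lr (x\<^sup>2)) = 1 - \<alpha>"
      "\<And>t. 0 < t \<Longrightarrow> t < x \<Longrightarrow> 2 / \<nu> * (t\<^sup>2 * Lr (t\<^sup>2)) < 1 - \<alpha>" "starlike_radius \<alpha> (f_norm s \<nu> q) = ereal x"
      using starlike_radius_pos[OF c assms(6) \<rho> zero_less_numeral holf ld] by blast
    have iff: "2 * (t\<^sup>2 * Lr (t\<^sup>2)) = \<nu> - \<alpha> * \<nu> \<longleftrightarrow> 2 / \<nu> * (t\<^sup>2 * Lr (t\<^sup>2)) = 1 - \<alpha>" for t
      using \<nu> by (simp add: field_simps) auto
    have "smallest_positive_root (\<lambda>r. of_real r * deriv J (of_real r) - of_real (\<alpha> * \<nu>) * J (of_real r)) x"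
      unfolding smallest_positive_root_def
    proof (intro conjI allI impI)
      show "of_real x * deriv J (of_real x) - of_real (\<alpha> * \<nu>) * J (of_real x) = 0"
        using root_iff_pos[OF J c0 x(1) sq_less[OF x(1,2)]] iff x(3) by blast
      show "of_real y * deriv J (of_real y) - of_real (\<alpha> * \<nu>) * J (of_real y) \<noteq> 0" if "0 < y \<and> y < x" for y
        using root_iff_pos[OF J c0 _ sq_less[of y], of "\<alpha> * \<nu>"] iff[of y] x(4)[of y] x(2) that by simp
    qed (rule x(1))
    with x(5) show "\<exists>x. smallest_positive_root (\<lambda>r. of_real r * deriv J (of_real r) - of_real (\<alpha> * \<nu>) * J (of_real r)) x
        \<and> starlike_radius \<alpha> (f_norm s \<nu> q) = ereal x" by blast
  next
    assume \<nu>: "\<nu> < 0"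
    \<comment> \<open>For negative \<nu> this inequality is the same as \<nu> > -1.\<close>
    have c: "2 / - \<nu> > 2" and \<nu>0: "\<nu> \<noteq> 0" using \<nu> assms(3) by (auto simp: field_simps)
    note lb = logderiv_log_branch[OF \<rho>(2,1) \<nu>0]
    have holf: "f_norm s \<nu> q holomorphic_on ball 0 \<rho>" unfolding fb by (rule lb(1))
    have ld: "z * deriv (f_norm s \<nu> q) z / f_norm s \<nu> q z = 1 + of_real (2 / - \<nu>) * (z\<^sup>2 * LP (z\<^sup>2))"
      if "z \<noteq> 0" "cmod z < \<rho>" for z
      unfolding fb lb(2)[OF that] by simp
    obtain x where x: "0 < x" "2 / - \<nu> * (x\<^sup>2 * Lr (- x\<^sup>2)) = 1 - \<alpha>"
      "\<And>t. 0 < t \<Longrightarrow> 2 / - \<nu> * (t\<^sup>2 * Lr (- t\<^sup>2)) = 1 - \<alpha> \<Longrightarrow> t = x" "starlike_radius \<alpha> (f_norm s \<nu> q) = ereal x"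
      using starlike_radius_neg[OF c assms(5,6) \<rho> holf ld] by blast
    have iff: "2 * (t\<^sup>2 * Lr (- t\<^sup>2)) = \<alpha> * \<nu> - \<nu> \<longleftrightarrow> 2 / - \<nu> * (t\<^sup>2 * Lr (- t\<^sup>2)) = 1 - \<alpha>" for t
      using \<nu> by (simp add: field_simps)
    have "unique_positive_root (\<lambda>r. \<i> * of_real r * deriv J (\<i> * of_real r) - of_real (\<alpha> * \<nu>) * J (\<i> * of_real r)) x"
      unfolding unique_positive_root_def
    proof (intro conjI allI impI)
      show "\<i> * of_real x * deriv J (\<i> * of_real x) - of_real (\<alpha> * \<nu>) * J (\<i> * of_real x) = 0"
        using root_iff_imaginary[OF J c0 x(1)] iff x(2) by blast
      show "y = x" if "y > 0 \<and> \<i> * of_real y * deriv J (\<i> * of_real y) - of_real (\<alpha> * \<nu>) * J (\<i> * of_real y) = 0" for y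
        using root_iff_imaginary[OF J c0, of y "\<alpha> * \<nu>"] iff[of y] x(3)[of y] that by blast
    qed (rule x(1))
    with x(4) show "\<exists>x. unique_positive_root (\<lambda>r. \<i> * of_real r * deriv J (\<i> * of_real r) - of_real (\<alpha> * \<nu>) * J (\<i> * of_real r)) x
        \<and> starlike_radius \<alpha> (f_norm s \<nu> q) = ereal x" by blast
  next
    have ld: "z * deriv (g_norm s \<nu> q) z / g_norm s \<nu> q z = 1 - of_real 2 * (z\<^sup>2 * LP (z\<^sup>2))"
      if z: "z \<noteq> 0" "cmod z < \<rho>" for z
    proof -
      have "P (z\<^sup>2) \<noteq> 0" by (rule P_nonzero) (use z sq_less[of "cmod z"] in \<open>simp add: norm_power\<close>)
      from logderiv_times_P_power[OF z(1) this] show ?thesis unfolding gb by simp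
    qed
    obtain x where x: "0 < x" "x < \<rho>" "2 * (x\<^sup>2 * Lr (x\<^sup>2)) = 1 - \<alpha>"
      "\<And>t. 0 < t \<Longrightarrow> t < x \<Longrightarrow> 2 * (t\<^sup>2 * Lr (t\<^sup>2)) < 1 - \<alpha>" "starlike_radius \<alpha> (g_norm s \<nu> q) = ereal x"
      using starlike_radius_pos[OF zero_less_numeral assms(6) \<rho> zero_less_numeral hol[of 2, folded gb] ld] by blast
    have "smallest_positive_root (\<lambda>r. of_real r * deriv J (of_real r) - of_real (\<alpha> + \<nu> - 1) * J (of_real r)) x"
      unfolding smallest_positive_root_def
    proof (intro conjI allI impI)
      show "of_real x * deriv J (of_real x) - of_real (\<alpha> + \<nu> - 1) * J (of_real x) = 0"
        using root_iff_pos[OF J c0 x(1) sq_less[OF x(1,2)], of "\<alpha> + \<nu> - 1"] x(3) by simp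
      show "of_real y * deriv J (of_real y) - of_real (\<alpha> + \<nu> - 1) * J (of_real y) \<noteq> 0" if "0 < y \<and> y < x" for y
        using root_iff_pos[OF J c0 _ sq_less[of y], of "\<alpha> + \<nu> - 1"] x(4)[of y] x(2) that by simp
    qed (rule x(1))
    with x(5) show "\<exists>y. smallest_positive_root (\<lambda>r. of_real r * deriv J (of_real r) - of_real (\<alpha> + \<nu> - 1) * J (of_real r)) y
        \<and> starlike_radius \<alpha> (g_norm s \<nu> q) = ereal y" by blast
  next
    have ld: "z * deriv (h_norm s \<nu> q) z / h_norm s \<nu> q z = 1 - of_real 1 * (z ^ 1 * LP (z ^ 1))"
      if z: "z \<noteq> 0" "cmod z < w1" for z
    proof -
      have "P (z ^ 1) \<noteq> 0" by (rule P_nonzero) (use z in simp)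
      from logderiv_times_P_power[OF z(1) this] show ?thesis unfolding hb by simp
    qed
    obtain x where x: "0 < x" "x < w1" "1 * (x ^ 1 * Lr (x ^ 1)) = 1 - \<alpha>"
      "\<And>t. 0 < t \<Longrightarrow> t < x \<Longrightarrow> 1 * (t ^ 1 * Lr (t ^ 1)) < 1 - \<alpha>" "starlike_radius \<alpha> (h_norm s \<nu> q) = ereal x"
      using starlike_radius_pos[OF zero_less_one assms(6) w1(1) power_one_right zero_less_one hol[of 1, folded hb] ld] by blast
    \<comment> \<open>Since \<open>h_norm\<close> is z P(z), the variable of P is the radius itself,
      while J at r involves P at \<open>r\<^sup>2\<close>. Hence J is evaluated at
      \<open>sqrt t\<close>: the radius is the square of the root in the argument of J.\<close>
    have root: "of_real (sqrt t) * deriv J (of_real (sqrt t)) - of_real (2 * \<alpha> + \<nu> - 2) * J (of_real (sqrt t)) = 0 \<longleftrightarrow> t * Lr t = 1 - \<alpha>"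
      if "0 < t" "t < w1" for t
      using root_iff_pos[OF J c0, of "sqrt t" "2 * \<alpha> + \<nu> - 2"] that by auto
    have "smallest_positive_root (\<lambda>r. of_real (sqrt r) * deriv J (of_real (sqrt r)) - of_real (2 * \<alpha> + \<nu> - 2) * J (of_real (sqrt r))) x"
      unfolding smallest_positive_root_def
    proof (intro conjI allI impI)
      show "of_real (sqrt x) * deriv J (of_real (sqrt x)) - of_real (2 * \<alpha> + \<nu> - 2) * J (of_real (sqrt x)) = 0"
        using root[OF x(1,2)] x(3) by simp
      show "of_real (sqrt y) * deriv J (of_real (sqrt y)) - of_real (2 * \<alpha> + \<nu> - 2) * J (of_real (sqrt y)) \<noteq> 0" if "0 < y \<and> y < x" for y
        using root[of y] x(4)[of y] x(2) that by simp
    qed (rule x(1))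
    with x(5) show "\<exists>z. smallest_positive_root (\<lambda>r. of_real (sqrt r) * deriv J (of_real (sqrt r)) - of_real (2 * \<alpha> + \<nu> - 2) * J (of_real (sqrt r))) z
        \<and> starlike_radius \<alpha> (h_norm s \<nu> q) = ereal z" by blast
  qed
qed

end
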